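(* Let $0<p<\infty$, let $\omega$ be an admissible weight on $\mathbb{D}$ (with respect to the exponent $p$), and let $X=(X_n)_{n\ge 0}$ be a standard random sequence. Then $$(A^p_\omega)_\star = H(2,p;\omega_{\mathrm r}).$$ That is, for $f(z)=\sum_{n\ge0}a_nz^n\in H(\mathbb{D})$, one has $\mathbb{P}(\mathcal{R}_Xf\in A^p_\omega)=1$ if and only if $\int_0^1 M_2(f,s)^p\,d\omega_{\mathrm r}(s)<\infty$.
   Context: $\mathbb{D}$ is the open unit disk in $\mathbb{C}$, $H(\mathbb{D})$ the space of analytic functions on $\mathbb{D}$, and $dA=\frac1\pi r\,dr\,d\theta$ normalized area measure. A weight $\omega$ is a positive measurable function on $\mathbb{D}$ (not necessarily radial). Weighted Bergman space: for $0<p<\infty$, $A^p_\omega$ is the set of $f\in H(\mathbb{D})$ with $\|f\|=\left(\int_{\mathbb{D}}|f|^p\omega\,dA\right)^{1/p}<\infty$. Admissible weight (with respect to $p$): (1) finite mass: $\int_{\mathbb{D}}\omega\,dA<\infty$; (2) bounded point evaluations: for every $z\in\mathbb{D}$ the functional $L_z(f)=f(z)$ is continuous on $A^p_\omega$, and $\sup_{z\in K}\|L_z\|<\infty$ for each compact $K\subset\mathbb{D}$; (3) $\lim_{r\to1^-}\|f_r-f\|=0$ for every $f\in A^p_\omega$, where $f_r(z)=f(rz)$. Standard random sequence: a sequence $(X_n)_{n\ge0}$ of independent identically distributed random variables, which are all Bernoulli ($\pm1$ with probability $1/2$ each), or all Steinhaus (uniform on the unit circle), or all Gaussian $\mathcal{N}(0,1)$.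 For $f(z)=\sum_{n\ge 0} a_nz^n\in H(\mathbb{D})$, $(\mathcal{R}_Xf)(z)=\sum_{n\ge 0} a_nX_nz^n$. For a space $\mathcal{X}$ of analytic functions on $\mathbb{D}$, the random symbol space is $(\mathcal{X})_\star=\{f\in H(\mathbb{D}):\mathbb{P}(\mathcal{R}_Xf\in\mathcal{X})=1\}$. Radial projection: $\overline{\omega}(s)=\frac1{2\pi}\int_0^{2\pi}\omega(se^{i\theta})\,d\theta$, and $d\omega_{\mathrm r}(s)=\overline{\omega}(s)\,2s\,ds$ on $(0,1)$. $M_p(f,r)=\left(\int_0^{2\pi}|f(re^{i\theta})|^p\frac{d\theta}{2\pi}\right)^{1/p}$, and $H(2,p;\omega_{\mathrm r})$ is the set of $f\in H(\mathbb{D})$ with $\int_0^1M_2(f,s)^p\,d\omega_{\mathrm r}(s)<\infty$. *)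

theory Defs
  imports "HOL-Probability.Probability" "HOL-Complex_Analysis.Complex_Analysis"
begin

definition disk :: "complex set" where
  "disk = ball 0 1"

definition disk_area :: "complex measure" where
  "disk_area = scale_measure (ennreal (1 / pi)) (restrict_space lebesgue disk)"

definition weight :: "(complex \<Rightarrow> real) \<Rightarrow> bool" where
  "weight \<omega> \<longleftrightarrow> \<omega> \<in> borel_measurable disk_area \<and> (\<forall>z\<in>disk. 0 < \<omega> z)"

text \<open>
  Analytic functions on the disk are represented by functions on the whole plane that are
  holomorphic on the disk; no notion below depends on their values outside the disk.
\<close>

definition bergman_integral :: "real \<Rightarrow> (complex \<Rightarrow> real) \<Rightarrow> (complex \<Rightarrow> complex) \<Rightarrow> ennreal" where
  "bergman_integral p \<omega> f = (\<integral>\<^sup>+z. ennreal (cmod (f z) powr p * \<omega> z) \<partial>disk_area)"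

definition bergman_norm :: "real \<Rightarrow> (complex \<Rightarrow> real) \<Rightarrow> (complex \<Rightarrow> complex) \<Rightarrow> ennreal" where
  "bergman_norm p \<omega> f =
     (if bergman_integral p \<omega> f = \<infinity> then \<infinity>
      else ennreal (enn2real (bergman_integral p \<omega> f) powr (1 / p)))"

definition bergman_space :: "real \<Rightarrow> (complex \<Rightarrow> real) \<Rightarrow> (complex \<Rightarrow> complex) set" where
  "bergman_space p \<omega> = {f. f holomorphic_on disk \<and> bergman_norm p \<omega> f < \<infinity>}"

text \<open>
  The point evaluation at \<open>z\<close> is the functional taking \<open>f\<close> to \<open>f z\<close>. Its continuity is
  spelled out with the (quasi-)norm, since for \<open>p < 1\<close> the latter is not a norm.
\<close>

definition point_eval_continuous :: "real \<Rightarrow> (complex \<Rightarrow> real) \<Rightarrow> complex \<Rightarrow> bool" where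
  "point_eval_continuous p \<omega> z \<longleftrightarrow>
     (\<forall>f\<in>bergman_space p \<omega>. \<forall>\<epsilon>>0. \<exists>\<delta>>0. \<forall>g\<in>bergman_space p \<omega>.
        bergman_norm p \<omega> (\<lambda>w. g w - f w) < ennreal \<delta> \<longrightarrow> cmod (g z - f z) < \<epsilon>)"

definition point_eval_norm :: "real \<Rightarrow> (complex \<Rightarrow> real) \<Rightarrow> complex \<Rightarrow> ennreal" where
  "point_eval_norm p \<omega> z =
     (SUP f\<in>{f \<in> bergman_space p \<omega>. bergman_norm p \<omega> f \<le> 1}. ennreal (cmod (f z)))"

definition admissible_weight :: "real \<Rightarrow> (complex \<Rightarrow> real) \<Rightarrow> bool" where
  "admissible_weight p \<omega> \<longleftrightarrow>
     weight \<omega> \<and>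
     (\<integral>\<^sup>+z. ennreal (\<omega> z) \<partial>disk_area) < \<infinity> \<and>
     (\<forall>z\<in>disk. point_eval_continuous p \<omega> z) \<and>
     (\<forall>K. compact K \<and> K \<subseteq> disk \<longrightarrow> (SUP z\<in>K. point_eval_norm p \<omega> z) < \<infinity>) \<and>
     (\<forall>f\<in>bergman_space p \<omega>.
        ((\<lambda>r. bergman_norm p \<omega> (\<lambda>z. f (of_real r * z) - f z)) \<longlongrightarrow> 0) (at_left (1::real)))"

definition bernoulli_law :: "complex measure" where
  "bernoulli_law = distr (measure_pmf (pmf_of_set {1, - 1})) borel (\<lambda>x. x)"

definition steinhaus_law :: "complex measure" where
  "steinhaus_law = distr (uniform_measure lborel {0..2 * pi}) borel cis"

text \<open>The Gaussian variables are real; they are embedded into the complex numbers.\<close>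

definition gaussian_law :: "complex measure" where
  "gaussian_law =
     distr (density lborel (\<lambda>x. ennreal (std_normal_density x))) borel complex_of_real"

definition standard_random_sequence :: "'a measure \<Rightarrow> (nat \<Rightarrow> 'a \<Rightarrow> complex) \<Rightarrow> bool" where
  "standard_random_sequence M X \<longleftrightarrow>
     prob_space.indep_vars M (\<lambda>_. borel) X UNIV \<and>
     ((\<forall>n. distr M borel (X n) = bernoulli_law) \<or>
      (\<forall>n. distr M borel (X n) = steinhaus_law) \<or>
      (\<forall>n. distr M borel (X n) = gaussian_law))"

text \<open>
  For \<open>f\<close> holomorphic on the disk and a standard random sequence, the randomized series
  converges on the whole disk almost surely, so the value of \<open>eval_fps\<close> at points of
  divergence affects only a null event.
\<close>

definition randomize ::
  "(nat \<Rightarrow> 'a \<Rightarrow> complex) \<Rightarrow> (complex \<Rightarrow> complex) \<Rightarrow> 'a \<Rightarrow> complex \<Rightarrow> complex" where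
  "randomize X f x = eval_fps (Abs_fps (\<lambda>n. fps_nth (fps_expansion f 0) n * X n x))"

definition random_symbol_space ::
  "'a measure \<Rightarrow> (nat \<Rightarrow> 'a \<Rightarrow> complex) \<Rightarrow> (complex \<Rightarrow> complex) set \<Rightarrow> (complex \<Rightarrow> complex) set" where
  "random_symbol_space M X S = {f. f holomorphic_on disk \<and> (AE x in M. randomize X f x \<in> S)}"

text \<open>
  For a Lebesgue measurable weight, the restriction to the circle of radius \<open>s\<close> is Lebesgue
  measurable for almost every \<open>s\<close>, hence the integral over \<open>lebesgue\<close> rather than \<open>lborel\<close>.
\<close>

definition radial_projection :: "(complex \<Rightarrow> real) \<Rightarrow> real \<Rightarrow> ennreal" where
  "radial_projection \<omega> s =
     ennreal (1 / (2 * pi)) * (\<integral>\<^sup>+\<theta>\<in>{0..2 * pi}. ennreal (\<omega> (of_real s * cis \<theta>)) \<partial>lebesgue)"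

definition radial_measure :: "(complex \<Rightarrow> real) \<Rightarrow> real measure" where
  "radial_measure \<omega> =
     density (restrict_space lebesgue {0<..<1}) (\<lambda>s. radial_projection \<omega> s * ennreal (2 * s))"

definition integral_mean :: "real \<Rightarrow> (complex \<Rightarrow> complex) \<Rightarrow> real \<Rightarrow> real" where
  "integral_mean p f r =
     (1 / (2 * pi) * (LINT \<theta>:{0..2 * pi}|lborel. cmod (f (of_real r * cis \<theta>)) powr p)) powr (1 / p)"

definition mixed_norm_space :: "real \<Rightarrow> real \<Rightarrow> real measure \<Rightarrow> (complex \<Rightarrow> complex) set" where
  "mixed_norm_space q p \<mu> =
     {f. f holomorphic_on disk \<and> (\<integral>\<^sup>+s. ennreal (integral_mean q f s powr p) \<partial>\<mu>) < \<infinity>}"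

end

theory Submission
  imports Defs
begin

text \<open>
  For fixed \<open>z\<close>, the value \<open>S z\<close> of the randomized series is a weighted sum of independent
  sub-Gaussian variables, so its \<open>p\<close>-th moment is at most a constant times \<open>\<sigma> z powr p\<close>, where
  \<open>\<sigma> z = M\<^sub>2(f, \<bar>z\<bar>)\<close> by Parseval. Integrating against \<open>\<omega>\<close> gives the inclusion \<open>\<supseteq>\<close>.
  Conversely, the Paley--Zygmund inequality gives an absolute \<open>\<eta> > 0\<close> with
  \<open>P(\<bar>S z\<bar> \<ge> \<sigma> z / 2) \<ge> \<eta>\<close> for all \<open>z\<close>. If the Bergman integral of the randomized series is almost
  surely finite, it is bounded on an event \<open>E\<close> of probability at least \<open>1 - \<eta> / 2\<close>, and
  \<open>\<bar>S z\<bar> \<ge> \<sigma> z / 2\<close> still has probability at least \<open>\<eta> / 2\<close> within \<open>E\<close>; integrating over \<open>E\<close> bounds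
  the integral of \<open>\<sigma> powr p\<close> against \<open>\<omega>\<close>. Kahane's inequality in \<open>A\<^sup>p\<close> is thereby avoided.
\<close>

subsection \<open>Polar coordinates\<close>

text \<open>Lebesgue measure is determined by its values on boxes, and the preimage of a box under
  \<open>Complex\<close> is a product of two intervals. This opens the plane to Fubini in the real
  and imaginary parts.\<close>

lemma lborel_complex_eq_distr:
  "(lborel :: complex measure) = distr (lborel \<Otimes>\<^sub>M lborel) borel (\<lambda>(x, y). Complex x y)"
proof (rule lborel_eqI)
  have [measurable]: "(\<lambda>(x, y). Complex x y) \<in> borel_measurable (borel \<Otimes>\<^sub>M borel)"
    by (simp add: complex_eq_iff Complex_eq case_prod_beta)
  fix l u :: complex
  assume le: "\<And>b. b \<in> Basis \<Longrightarrow> l \<bullet> b \<le> u \<bullet> b"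
  have "Re l \<le> Re u" "Im l \<le> Im u"
    using le[of 1] le[of \<i>] by (auto simp: Basis_complex_def)
  have "emeasure (distr (lborel \<Otimes>\<^sub>M lborel) borel (\<lambda>(x, y). Complex x y)) (box l u)
      = emeasure (lborel \<Otimes>\<^sub>M lborel) ({Re l<..<Re u} \<times> {Im l<..<Im u})"
    by (subst emeasure_distr)
       (auto intro!: arg_cong[where f = "emeasure _"] simp: space_pair_measure box_def Basis_complex_def)
  also have "\<dots> = ennreal (Re u - Re l) * ennreal (Im u - Im l)"
    using \<open>Re l \<le> Re u\<close> \<open>Im l \<le> Im u\<close> by (subst lborel.emeasure_pair_measure_Times) auto
  also have "\<dots> = (\<Prod>b\<in>Basis. (u - l) \<bullet> b)"
    using \<open>Re l \<le> Re u\<close> \<open>Im l \<le> Im u\<close> by (simp add: Basis_complex_def ennreal_mult)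
  finally show "emeasure (distr (lborel \<Otimes>\<^sub>M lborel) borel (\<lambda>(x, y). Complex x y)) (box l u)
      = (\<Prod>b\<in>Basis. (u - l) \<bullet> b)" .
qed simp

lemma nn_integral_lborel_translate:
  fixes f :: "'a::euclidean_space \<Rightarrow> ennreal"
  assumes [measurable]: "f \<in> borel_measurable borel"
  shows "(\<integral>\<^sup>+x. f (c + x) \<partial>lborel) = (\<integral>\<^sup>+x. f x \<partial>lborel)"
  by (subst (2) lborel_distr_plus[of c, symmetric]) (simp add: nn_integral_distr)

lemma measurable_Complex [measurable (raw)]:
  assumes "f \<in> borel_measurable M" "g \<in> borel_measurable M"
  shows "(\<lambda>x. Complex (f x) (g x)) \<in> borel_measurable M"
  using assms by (simp add: Complex_eq)

text \<open>Both orders of integration are kept because a shear moves one coordinate by an amount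
  depending on the other: the moved coordinate has to be the inner variable.\<close>

lemma
  fixes h :: "complex \<Rightarrow> ennreal"
  assumes [measurable]: "h \<in> borel_measurable borel"
  shows nn_integral_complex: "(\<integral>\<^sup>+z. h z \<partial>lborel) = (\<integral>\<^sup>+y. \<integral>\<^sup>+x. h (Complex x y) \<partial>lborel \<partial>lborel)"
    and nn_integral_complex': "(\<integral>\<^sup>+z. h z \<partial>lborel) = (\<integral>\<^sup>+x. \<integral>\<^sup>+y. h (Complex x y) \<partial>lborel \<partial>lborel)"
proof -
  have *: "(\<integral>\<^sup>+z. h z \<partial>lborel) = (\<integral>\<^sup>+w. h (Complex (fst w) (snd w)) \<partial>(lborel \<Otimes>\<^sub>M lborel))"
    by (subst lborel_complex_eq_distr, subst nn_integral_distr) (auto simp: case_prod_beta)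
  show "(\<integral>\<^sup>+z. h z \<partial>lborel) = (\<integral>\<^sup>+y. \<integral>\<^sup>+x. h (Complex x y) \<partial>lborel \<partial>lborel)"
    unfolding * by (subst lborel_pair.nn_integral_snd[symmetric]) auto
  show "(\<integral>\<^sup>+z. h z \<partial>lborel) = (\<integral>\<^sup>+x. \<integral>\<^sup>+y. h (Complex x y) \<partial>lborel \<partial>lborel)"
    unfolding * by (subst lborel.nn_integral_fst[symmetric]) auto
qed

text \<open>For a fixed imaginary part \<open>y\<close> the shear is a translation of the real line
  by \<open>t * y\<close>, which leaves the inner integral unchanged.\<close>

lemma nn_integral_shear_Re:
  fixes h :: "complex \<Rightarrow> ennreal"
  assumes [measurable]: "h \<in> borel_measurable borel"
  shows "(\<integral>\<^sup>+z. h (Complex (Re z + t * Im z) (Im z)) \<partial>lborel) = (\<integral>\<^sup>+z. h z \<partial>lborel)"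
proof -
  have "(\<integral>\<^sup>+x. h (Complex (x + t * y) y) \<partial>lborel) = (\<integral>\<^sup>+x. h (Complex x y) \<partial>lborel)" for y
    using nn_integral_lborel_translate[of "\<lambda>x. h (Complex x y)" "t * y"] by (simp add: add.commute)
  then show ?thesis
    by (simp add: nn_integral_complex)
qed

lemma nn_integral_shear_Im:
  fixes h :: "complex \<Rightarrow> ennreal"
  assumes [measurable]: "h \<in> borel_measurable borel"
  shows "(\<integral>\<^sup>+z. h (Complex (Re z) (Im z + t * Re z)) \<partial>lborel) = (\<integral>\<^sup>+z. h z \<partial>lborel)"
proof -
  have "(\<integral>\<^sup>+y. h (Complex x (y + t * x)) \<partial>lborel) = (\<integral>\<^sup>+y. h (Complex x y) \<partial>lborel)" for x
    using nn_integral_lborel_translate[of "\<lambda>y. h (Complex x y)" "t * x"] by (simp add: add.commute)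
  then show ?thesis
    by (simp add: nn_integral_complex')
qed

text \<open>A rotation other than the half turn is a product of three shears.\<close>

lemma nn_integral_rotate:
  fixes h :: "complex \<Rightarrow> ennreal"
  assumes [measurable]: "h \<in> borel_measurable borel" and u: "cmod u = 1"
  shows "(\<integral>\<^sup>+z. h (u * z) \<partial>lborel) = (\<integral>\<^sup>+z. h z \<partial>lborel)"
proof -
  have rot: "(\<integral>\<^sup>+z. k (v * z) \<partial>lborel) = (\<integral>\<^sup>+z. k z \<partial>lborel)"
    if [measurable]: "k \<in> borel_measurable borel" and v: "cmod v = 1" and "Re v \<noteq> -1"
    for k :: "complex \<Rightarrow> ennreal" and v
  proof -
    \<comment> \<open>\<open>t\<close> is the tangent of half the rotation angle, whence the
      exclusion of \<open>Re v = -1\<close>. Since \<open>t * s = 1 - c\<close> and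
      \<open>t * (1 + c) = s\<close>, the horizontal shears \<open>A\<close> by \<open>- t\<close>
      and the vertical shear \<open>B\<close> by \<open>s\<close> compose to multiplication by
      \<open>v\<close>.\<close>
    define c s t where "c = Re v" and "s = Im v" and "t = s / (1 + c)"
    have cs: "c\<^sup>2 + s\<^sup>2 = 1" and "1 + c \<noteq> 0"
      using v that(3) by (auto simp: c_def s_def cmod_def add_eq_0_iff)
    have ts: "t * s = 1 - c" and tc: "t * (1 + c) = s"
      using cs \<open>1 + c \<noteq> 0\<close> by (auto simp: t_def field_simps power2_eq_square)
    define A B :: "complex \<Rightarrow> complex"
      where "A z = Complex (Re z + (- t) * Im z) (Im z)"
        and "B z = Complex (Re z) (Im z + s * Re z)" for z
    have [measurable]: "A \<in> borel_measurable borel" "B \<in> borel_measurable borel"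
      unfolding A_def B_def by measurable
    have "A (B (A z)) = v * z" for z
    proof (rule complex_eqI)
      have "Re (A (B (A z))) = (1 - t * s) * Re z - t * (1 + (1 - t * s)) * Im z"
        by (simp add: A_def B_def algebra_simps)
      also have "1 - t * s = c"
        by (simp add: ts)
      finally show "Re (A (B (A z))) = Re (v * z)"
        by (simp add: tc) (simp add: c_def s_def)
      have "Im (A (B (A z))) = s * Re z + (1 - t * s) * Im z"
        by (simp add: A_def B_def algebra_simps)
      also have "1 - t * s = c"
        by (simp add: ts)
      finally show "Im (A (B (A z))) = Im (v * z)"
        by (simp add: c_def s_def)
    qed
    then have "(\<integral>\<^sup>+z. k (v * z) \<partial>lborel) = (\<integral>\<^sup>+z. k (A (B (A z))) \<partial>lborel)"
      by simp
    also have "\<dots> = (\<integral>\<^sup>+z. k (A (B z)) \<partial>lborel)"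
      using nn_integral_shear_Re[of "\<lambda>z. k (A (B z))" "-t"] by (simp add: A_def)
    also have "\<dots> = (\<integral>\<^sup>+z. k (A z) \<partial>lborel)"
      using nn_integral_shear_Im[of "\<lambda>z. k (A z)" s] by (simp add: B_def)
    also have "\<dots> = (\<integral>\<^sup>+z. k z \<partial>lborel)"
      using nn_integral_shear_Re[of k "-t"] by (simp add: A_def)
    finally show ?thesis .
  qed
  show ?thesis
  proof (cases "Re u = -1")
    case True
    then have "(Im u)\<^sup>2 = 0"
      using u by (simp add: cmod_def)
    \<comment> \<open>The half turn is two quarter turns, and \<open>Re \<i> = 0\<close> falls under
      the case already treated.\<close>
    with True have "u = \<i> * \<i>"
      by (simp add: complex_eq_iff)
    then have "(\<integral>\<^sup>+z. h (u * z) \<partial>lborel) = (\<integral>\<^sup>+z. h (\<i> * (\<i> * z)) \<partial>lborel)"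
      by (simp add: mult.assoc)
    also have "\<dots> = (\<integral>\<^sup>+z. h (\<i> * z) \<partial>lborel)"
      by (rule rot[of "\<lambda>z. h (\<i> * z)"]) auto
    also have "\<dots> = (\<integral>\<^sup>+z. h z \<partial>lborel)"
      by (rule rot) auto
    finally show ?thesis .
  qed (use u rot in auto)
qed

lemma measurable_cis [measurable]: "cis \<in> borel_measurable borel"
  by (intro borel_measurable_continuous_onI continuous_intros)

text \<open>Multiplication by \<open>cis \<alpha>\<close> shifts the interval of angles by
  \<open>\<alpha>\<close>; the piece beyond \<open>2 * pi\<close> is moved back to
  \<open>{0..\<alpha>}\<close> by periodicity of \<open>cis\<close>.\<close>

lemma nn_integral_circle_rotate:
  fixes h :: "complex \<Rightarrow> ennreal"
  assumes [measurable]: "h \<in> borel_measurable borel" and u: "cmod u = 1"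
  shows "(\<integral>\<^sup>+\<theta>\<in>{0..2 * pi}. h (u * cis \<theta>) \<partial>lborel) = (\<integral>\<^sup>+\<theta>\<in>{0..2 * pi}. h (cis \<theta>) \<partial>lborel)"
proof -
  define \<alpha> where "\<alpha> = Arg2pi u"
  have \<alpha>: "0 \<le> \<alpha>" "\<alpha> < 2 * pi" "u = cis \<alpha>"
    using Arg2pi[of u] u by (auto simp: \<alpha>_def is_Arg_def cis_conv_exp)
  have shift: "(\<integral>\<^sup>+\<theta>. h (cis (c + \<theta>)) * indicator {a..b} \<theta> \<partial>lborel)
      = (\<integral>\<^sup>+\<theta>. h (cis \<theta>) * indicator {a + c..b + c} \<theta> \<partial>lborel)" for a b c
    using nn_integral_lborel_translate[of "\<lambda>\<theta>. h (cis \<theta>) * indicator {a + c..b + c} \<theta>" c]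
    by (simp add: indicator_def cong: if_cong)
  have split: "(\<integral>\<^sup>+\<theta>. h (cis \<theta>) * indicator {a..c} \<theta> \<partial>lborel)
      = (\<integral>\<^sup>+\<theta>. h (cis \<theta>) * indicator {a..b} \<theta> \<partial>lborel) + (\<integral>\<^sup>+\<theta>. h (cis \<theta>) * indicator {b..c} \<theta> \<partial>lborel)"
    if "a \<le> b" "b \<le> c" for a b c
  proof -
    \<comment> \<open>The two closed intervals overlap in the single point \<open>b\<close>, a null
      set.\<close>
    have "(\<integral>\<^sup>+\<theta>. h (cis \<theta>) * indicator {a..c} \<theta> \<partial>lborel)
      = (\<integral>\<^sup>+\<theta>. h (cis \<theta>) * indicator {a..b} \<theta> + h (cis \<theta>) * indicator {b..c} \<theta> \<partial>lborel)"
      using AE_lborel_singleton[of b] that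
      by (intro nn_integral_cong_AE) (auto elim!: eventually_mono simp: indicator_def)
    then show ?thesis
      by (simp add: nn_integral_add)
  qed
  have "(\<integral>\<^sup>+\<theta>\<in>{0..2 * pi}. h (u * cis \<theta>) \<partial>lborel)
      = (\<integral>\<^sup>+\<theta>\<in>{\<alpha>..2 * pi}. h (cis \<theta>) \<partial>lborel) + (\<integral>\<^sup>+\<theta>\<in>{2 * pi..2 * pi + \<alpha>}. h (cis \<theta>) \<partial>lborel)"
    using shift[of \<alpha> 0 "2 * pi"] split[of \<alpha> "2 * pi" "2 * pi + \<alpha>"] \<alpha>
    by (simp add: cis_mult add.commute)
  also have "(\<integral>\<^sup>+\<theta>\<in>{2 * pi..2 * pi + \<alpha>}. h (cis \<theta>) \<partial>lborel) = (\<integral>\<^sup>+\<theta>\<in>{0..\<alpha>}. h (cis \<theta>) \<partial>lborel)"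
    using shift[of "2 * pi" 0 \<alpha>] by (simp add: add.commute flip: cis_mult)
  finally show ?thesis
    using split[of 0 \<alpha> "2 * pi"] \<alpha> by (simp add: add.commute)
qed

text \<open>The half-lines \<open>{..a}\<close> generate the Borel sets, and there both sides give
  the area \<open>pi * a\<^sup>2\<close> of a disk. For negative \<open>s\<close> the density
  vanishes because \<open>ennreal\<close> truncates at zero.\<close>

lemma distr_cmod_lborel:
  "distr lborel borel cmod = density lborel (\<lambda>s. ennreal (2 * pi * s))"
proof (rule measure_eqI_generator_eq[where E = "range atMost" and A = "\<lambda>n. {..real n}" and \<Omega> = UNIV])
  have eq: "emeasure (distr lborel borel cmod) {..a} = ennreal (pi * (max 0 a)\<^sup>2)" for a
  proof -
    have "emeasure (distr lborel borel cmod) {..a} = emeasure lborel (cball (0::complex) a)"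
      by (subst emeasure_distr) (auto intro!: arg_cong[where f = "emeasure _"])
    then show ?thesis
      by (cases "a \<ge> 0") (simp_all add: emeasure_cball unit_ball_vol_2 mult.commute cball_empty)
  qed
  have "emeasure (density lborel (\<lambda>s. ennreal (2 * pi * s))) {..a} = ennreal (pi * (max 0 a)\<^sup>2)" for a
  proof -
    have "emeasure (density lborel (\<lambda>s. ennreal (2 * pi * s))) {..a}
        = (\<integral>\<^sup>+s. ennreal (2 * pi * s) * indicator {0..max 0 a} s \<partial>lborel)"
      by (subst emeasure_density)
         (auto intro!: nn_integral_cong simp: indicator_def ennreal_eq_0_iff mult_le_0_iff max_def)
    also have "\<dots> = ennreal (pi * (max 0 a)\<^sup>2 - pi * 0\<^sup>2)"
      by (rule nn_integral_FTC_Icc) (auto intro!: derivative_eq_intros)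
    finally show ?thesis by simp
  qed
  with eq show "\<And>X. X \<in> range atMost \<Longrightarrow> emeasure (distr lborel borel cmod) X
      = emeasure (density lborel (\<lambda>s. ennreal (2 * pi * s))) X"
    by auto
  show "emeasure (distr lborel borel cmod) {..real i} \<noteq> \<infinity>" for i
    by (simp add: eq)
  show "Int_stable (range (atMost :: real \<Rightarrow> _))"
    by (auto simp: Int_stable_def)
  show "(\<Union>i. {..real i}) = UNIV"
    using real_arch_simple by auto
qed (auto simp: borel_eq_atMost)

text \<open>Rotation invariance allows averaging \<open>h (cis \<theta> * z)\<close> over all
  angles. After Fubini the inner angular integral depends only on \<open>cmod z\<close>, whose
  distribution is \<open>distr_cmod_lborel\<close>; the factor \<open>2 * pi\<close> then cancels.
  No Jacobian is computed.\<close>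

lemma nn_integral_polar:
  fixes h :: "complex \<Rightarrow> ennreal"
  assumes [measurable]: "h \<in> borel_measurable borel"
  shows "(\<integral>\<^sup>+z. h z \<partial>lborel)
    = (\<integral>\<^sup>+s. ennreal s * (\<integral>\<^sup>+\<theta>\<in>{0..2 * pi}. h (of_real s * cis \<theta>) \<partial>lborel) \<partial>lborel)"
proof -
  define H where "H s = (\<integral>\<^sup>+\<theta>\<in>{0..2 * pi}. h (of_real s * cis \<theta>) \<partial>lborel)" for s
  have [measurable]: "H \<in> borel_measurable borel"
    unfolding H_def by measurable
  have H_cmod: "(\<integral>\<^sup>+\<theta>\<in>{0..2 * pi}. h (cis \<theta> * z) \<partial>lborel) = H (cmod z)" for z
  proof -
    have "(\<integral>\<^sup>+\<theta>\<in>{0..2 * pi}. h (cis \<theta> * z) \<partial>lborel)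
        = (\<integral>\<^sup>+\<theta>\<in>{0..2 * pi}. h (of_real (cmod z) * (cis (Arg2pi z) * cis \<theta>)) \<partial>lborel)"
    proof -
      have "z = of_real (cmod z) * cis (Arg2pi z)"
        using Arg2pi[of z] by (simp add: is_Arg_def cis_conv_exp)
      then have "h (cis \<theta> * z) = h (of_real (cmod z) * (cis (Arg2pi z) * cis \<theta>))" for \<theta>
        by (metis mult.assoc mult.commute)
      then show ?thesis by (simp only:)
    qed
    also have "\<dots> = H (cmod z)"
      unfolding H_def by (rule nn_integral_circle_rotate) auto
    finally show ?thesis .
  qed
  have "ennreal (2 * pi) * (\<integral>\<^sup>+z. h z \<partial>lborel)
      = (\<integral>\<^sup>+\<theta>. (\<integral>\<^sup>+z. h (cis \<theta> * z) \<partial>lborel) * indicator {0..2 * pi} \<theta> \<partial>lborel)"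
    by (simp add: nn_integral_rotate nn_integral_cmult) (simp add: mult.commute)
  also have "\<dots> = (\<integral>\<^sup>+\<theta>. \<integral>\<^sup>+z. h (cis \<theta> * z) * indicator {0..2 * pi} \<theta> \<partial>lborel \<partial>lborel)"
    by (simp add: nn_integral_multc)
  also have "\<dots> = (\<integral>\<^sup>+z. \<integral>\<^sup>+\<theta>. h (cis \<theta> * z) * indicator {0..2 * pi} \<theta> \<partial>lborel \<partial>lborel)"
    by (rule lborel_pair.Fubini') measurable
  also have "\<dots> = (\<integral>\<^sup>+z. H (cmod z) \<partial>lborel)"
    by (simp add: H_cmod)
  also have "\<dots> = (\<integral>\<^sup>+s. H s \<partial>distr lborel borel cmod)"
    by (simp add: nn_integral_distr)
  also have "\<dots> = (\<integral>\<^sup>+s. ennreal (2 * pi) * (ennreal s * H s) \<partial>lborel)"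
    unfolding distr_cmod_lborel by (subst nn_integral_density) (auto simp: ennreal_mult' mult.assoc)
  also have "\<dots> = ennreal (2 * pi) * (\<integral>\<^sup>+s. ennreal s * H s \<partial>lborel)"
    by (simp add: nn_integral_cmult)
  finally show ?thesis
    by (simp add: ennreal_mult_cancel_left H_def)
qed

section \<open>Integration over the disk and the radial measure\<close>

lemma density_cong_AE:
  assumes "AE x in M. f x = g x"
  shows "density M f = density M g"
proof -
  have "(\<integral>\<^sup>+x. f x * indicator A x \<partial>M) = (\<integral>\<^sup>+x. g x * indicator A x \<partial>M)" for A
    using assms by (intro nn_integral_cong_AE) auto
  then show ?thesis
    by (simp add: density_def)
qed

lemma nn_integral_disk_area:
  assumes "h \<in> borel_measurable disk_area"
  shows "(\<integral>\<^sup>+z. h z \<partial>disk_area) = ennreal (1 / pi) * (\<integral>\<^sup>+z. h z * indicator disk z \<partial>lborel)"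
proof -
  have "(\<integral>\<^sup>+z. h z \<partial>disk_area) = ennreal (1 / pi) * (\<integral>\<^sup>+z. h z \<partial>restrict_space lebesgue disk)"
    unfolding disk_area_def
    by (rule nn_integral_scale_measure) (use assms in \<open>simp add: disk_area_def cong: measurable_cong_sets\<close>)
  then show ?thesis
    by (subst (asm) nn_integral_restrict_space) (simp_all add: nn_integral_completion disk_def)
qed

lemma measurable_disk_area_borel [measurable]: "(\<lambda>z. z) \<in> disk_area \<rightarrow>\<^sub>M borel"
proof -
  have "(\<lambda>z. z) \<in> restrict_space lebesgue disk \<rightarrow>\<^sub>M borel"
    by (intro measurable_restrict_space1 measurable_completion) simp
  then show ?thesis
    by (simp add: disk_area_def cong: measurable_cong_sets)
qed

lemma space_disk_area [simp]: "space disk_area = disk"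
  by (simp add: disk_area_def space_scale_measure space_restrict_space)

text \<open>Finiteness supplies the sigma-finiteness needed to exchange expectation and area
  integral.\<close>

lemma finite_measure_disk_area: "finite_measure disk_area"
proof
  have "emeasure disk_area disk = (\<integral>\<^sup>+z. 1 \<partial>disk_area)"
    by simp
  also have "\<dots> = ennreal (1 / pi) * emeasure lborel disk"
    by (subst nn_integral_disk_area) (auto simp: disk_def)
  also have "\<dots> < \<infinity>"
    using emeasure_bounded_finite[OF bounded_ball, of "0::complex" 1]
    by (simp add: disk_def ennreal_mult_less_top)
  finally show "emeasure disk_area (space disk_area) \<noteq> \<infinity>"
    by simp
qed

text \<open>This is integration in polar coordinates of a radial function against the weight. The
  weight is only Lebesgue measurable while \<open>nn_integral_polar\<close> asks for Borel
  functions, so it is replaced by a Borel function \<open>g\<close> equal to it almost everywhere;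
  the work lies in showing that this does not disturb almost every circle.\<close>

lemma nn_integral_radial_measure:
  fixes h :: "real \<Rightarrow> ennreal"
  assumes w: "weight \<omega>" and [measurable]: "h \<in> borel_measurable borel"
  shows "(\<integral>\<^sup>+z. h (cmod z) * ennreal (\<omega> z) \<partial>disk_area) = (\<integral>\<^sup>+s. h s \<partial>radial_measure \<omega>)"
proof -
  define w0 where "w0 z = ennreal (\<omega> z) * indicator disk z" for z
  have [measurable]: "disk \<in> sets borel"
    by (simp add: disk_def)
  have \<omega>[measurable]: "\<omega> \<in> borel_measurable disk_area"
    using w by (simp add: weight_def)
  then have "(\<lambda>z. ennreal (\<omega> z)) \<in> borel_measurable (restrict_space lebesgue disk)"
    by (simp add: disk_area_def cong: measurable_cong_sets)
  then have "w0 \<in> borel_measurable lebesgue"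
    unfolding w0_def by (subst (asm) borel_measurable_restrict_space_iff_ennreal) (auto simp: disk_def)
  from completion_ex_borel_measurable[OF this]
  obtain g where [measurable]: "g \<in> borel_measurable borel" and g: "AE z in lborel. w0 z = g z"
    by auto
  define G where "G s = (\<integral>\<^sup>+\<theta>\<in>{0..2 * pi}. g (of_real s * cis \<theta>) \<partial>lborel)" for s
  define W where "W s = (\<integral>\<^sup>+\<theta>\<in>{0..2 * pi}. w0 (of_real s * cis \<theta>) \<partial>lborel)" for s
  have [measurable]: "G \<in> borel_measurable borel"
    unfolding G_def by measurable
  from g obtain N where N: "{z \<in> space lborel. w0 z \<noteq> g z} \<subseteq> N" "emeasure lborel N = 0"
    and N_sets[measurable]: "N \<in> sets lborel"
    by (rule AE_E)
  then have g_w0: "g z = w0 z" if "z \<notin> N" for z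
    using that by force
  \<comment> \<open>Polar coordinates applied to the exceptional null set \<open>N\<close> show that
    almost every circle meets \<open>N\<close> in a null set of angles.\<close>
  have "(\<integral>\<^sup>+s. ennreal s * (\<integral>\<^sup>+\<theta>\<in>{0..2 * pi}. indicator N (of_real s * cis \<theta>) \<partial>lborel) \<partial>lborel) = 0"
    using nn_integral_polar[of "indicator N"] N N_sets by simp
  then have "AE s in lborel. ennreal s * (\<integral>\<^sup>+\<theta>\<in>{0..2 * pi}. indicator N (of_real s * cis \<theta>) \<partial>lborel) = 0"
    by (subst (asm) nn_integral_0_iff_AE) measurable
  then have GW: "AE s in lborel. 0 < s \<longrightarrow> G s = W s"
  proof (eventually_elim, intro impI)
    fix s :: real
    assume "ennreal s * (\<integral>\<^sup>+\<theta>\<in>{0..2 * pi}. indicator N (of_real s * cis \<theta>) \<partial>lborel) = 0" "0 < s"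
    then have "(\<integral>\<^sup>+\<theta>\<in>{0..2 * pi}. indicator N (of_real s * cis \<theta>) \<partial>lborel) = 0"
      by auto
    then have "AE \<theta> in lborel. (indicator N (of_real s * cis \<theta>) * indicator {0..2 * pi} \<theta> :: ennreal) = 0"
      by (subst (asm) nn_integral_0_iff_AE) auto
    then show "G s = W s"
      unfolding G_def W_def
      by (intro nn_integral_cong_AE) (auto elim!: eventually_mono simp: indicator_def g_w0 split: if_splits)
  qed
  have W_0: "W s = 0" if "1 \<le> s" for s
    using that by (simp add: W_def w0_def disk_def norm_mult)
  have W_proj: "radial_projection \<omega> s = ennreal (1 / (2 * pi)) * W s" if "0 < s" "s < 1" for s
    using that by (simp add: radial_projection_def W_def w0_def disk_def norm_mult nn_integral_completion)
  have "(\<integral>\<^sup>+z. h (cmod z) * ennreal (\<omega> z) \<partial>disk_area)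
      = ennreal (1 / pi) * (\<integral>\<^sup>+z. h (cmod z) * w0 z \<partial>lborel)"
    by (subst nn_integral_disk_area) (auto simp: w0_def mult.assoc)
  also have "(\<integral>\<^sup>+z. h (cmod z) * w0 z \<partial>lborel) = (\<integral>\<^sup>+z. h (cmod z) * g z \<partial>lborel)"
    using g by (intro nn_integral_cong_AE) auto
  also have "\<dots> = (\<integral>\<^sup>+s. ennreal s * (\<integral>\<^sup>+\<theta>\<in>{0..2 * pi}. h (cmod (of_real s * cis \<theta>)) * g (of_real s * cis \<theta>) \<partial>lborel) \<partial>lborel)"
    by (rule nn_integral_polar) measurable
  also have "\<dots> = (\<integral>\<^sup>+s. ennreal s * (h \<bar>s\<bar> * G s) \<partial>lborel)"
    by (simp add: norm_mult G_def nn_integral_cmult mult.assoc)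
  \<comment> \<open>Radii outside \<open>{0<..<1}\<close> contribute nothing:
    \<open>ennreal s\<close> is zero for \<open>s \<le> 0\<close>, and \<open>W s\<close> is zero
    for \<open>1 \<le> s\<close> because \<open>w0\<close> extends the weight by zero.\<close>
  also have "\<dots> = (\<integral>\<^sup>+s. ennreal s * G s * h s * indicator {0<..<1} s \<partial>lborel)"
    using GW
    by (intro nn_integral_cong_AE, eventually_elim)
       (auto simp: indicator_def W_0 ennreal_neg not_less mult_ac)
  also have "ennreal (1 / pi) * \<dots>
      = (\<integral>\<^sup>+s. ennreal (1 / (2 * pi)) * G s * ennreal (2 * s) * h s * indicator {0<..<1} s \<partial>lborel)"
  proof (subst nn_integral_cmult[symmetric], measurable, rule nn_integral_cong)
    fix s :: real
    have "ennreal (1 / pi) * ennreal s = ennreal (1 / (2 * pi)) * ennreal (2 * s)" if "0 < s"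
      using that by (simp add: ennreal_mult[symmetric])
    then show "ennreal (1 / pi) * (ennreal s * G s * h s * indicator {0<..<1} s)
        = ennreal (1 / (2 * pi)) * G s * ennreal (2 * s) * h s * indicator {0<..<1} s"
      by (auto simp: indicator_def) (metis mult.assoc mult.commute)
  qed
  also have "\<dots> = (\<integral>\<^sup>+s. ennreal (1 / (2 * pi)) * G s * ennreal (2 * s) * h s
      \<partial>restrict_space lebesgue {0<..<1})"
    by (subst nn_integral_restrict_space) (simp_all add: nn_integral_completion)
  also have "\<dots> = (\<integral>\<^sup>+s. h s \<partial>density (restrict_space lebesgue {0<..<1})
      (\<lambda>s. ennreal (1 / (2 * pi)) * G s * ennreal (2 * s)))"
    by (subst nn_integral_density) (auto intro!: measurable_restrict_space1 measurable_completion)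
  \<comment> \<open>\<open>radial_projection \<omega>\<close> is known only to agree almost
    everywhere with a Borel function, so the densities are compared without any measurability claim
    for it.\<close>
  also have "density (restrict_space lebesgue {0<..<1}) (\<lambda>s. ennreal (1 / (2 * pi)) * G s * ennreal (2 * s))
      = radial_measure \<omega>"
    unfolding radial_measure_def
  proof (rule density_cong_AE)
    have "AE s in lebesgue. 0 < s \<longrightarrow> G s = W s"
      using GW by (rule AE_completion)
    then show "AE s in restrict_space lebesgue {0<..<1}.
        ennreal (1 / (2 * pi)) * G s * ennreal (2 * s) = radial_projection \<omega> s * ennreal (2 * s)"
      by (subst AE_restrict_space_iff) (auto elim!: eventually_mono simp: W_proj)
  qed
  finally show ?thesis .
qed

subsection \<open>Sub-Gaussian random series\<close>

text \<open>The modulus is at most twice the larger of \<open>\<bar>Re w\<bar>\<close> and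
  \<open>\<bar>Im w\<bar>\<close>. The right-hand side involves only real parts of multiples of
  \<open>w\<close>, the form controlled by moment generating functions.\<close>

lemma exp_cmod_le:
  "exp (cmod w) \<le> exp (Re (2 * w)) + exp (Re (-2 * w)) + exp (Re (2 * \<i> * w)) + exp (Re (-2 * \<i> * w))"
proof -
  have *: "exp (2 * \<bar>a\<bar>) \<le> exp (2 * a) + exp (- 2 * a)" for a :: real
    by (cases "a \<ge> 0") auto
  have "cmod w \<le> 2 * \<bar>Re w\<bar> \<or> cmod w \<le> 2 * \<bar>Im w\<bar>"
    using cmod_le[of w] by linarith
  then have "exp (cmod w) \<le> exp (2 * \<bar>Re w\<bar>) + exp (2 * \<bar>Im w\<bar>)"
  proof
    assume "cmod w \<le> 2 * \<bar>Re w\<bar>"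
    then have "exp (cmod w) \<le> exp (2 * \<bar>Re w\<bar>)" by simp
    then show ?thesis by (smt (verit) exp_ge_zero)
  next
    assume "cmod w \<le> 2 * \<bar>Im w\<bar>"
    then have "exp (cmod w) \<le> exp (2 * \<bar>Im w\<bar>)" by simp
    then show ?thesis by (smt (verit) exp_ge_zero)
  qed
  then show ?thesis
    using *[of "Re w"] *[of "Im w"] by simp
qed

text \<open>Raise \<open>x / p \<le> exp (x / p)\<close> to the power \<open>p\<close>.\<close>

lemma powr_le_exp:
  fixes x p :: real
  assumes "0 \<le> x" "0 < p"
  shows "x powr p \<le> p powr p * exp x"
proof (cases "x = 0")
  case False
  have "x / p \<le> exp (x / p)"
    using exp_ge_add_one_self[of "x / p"] by linarith
  then have "(x / p) powr p \<le> exp (x / p) powr p"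
    using assms by (intro powr_mono2) auto
  then show ?thesis
    using assms False by (simp add: powr_divide field_simps exp_powr_real)
qed (use assms in auto)

text \<open>Expanding the square leaves only the diagonal. The lemma serves twice: for the random
  variables \<open>X n\<close>, and for the characters \<open>cis (real n * \<theta>)\<close> in
  Parseval's identity.\<close>

lemma norm2_orthonormal_sum:
  fixes e :: "nat \<Rightarrow> 'a \<Rightarrow> complex"
  assumes int: "\<And>m n. integrable M (\<lambda>x. e m x * cnj (e n x))"
    and orth: "\<And>m n. (\<integral>x. e m x * cnj (e n x) \<partial>M) = (if m = n then 1 else 0)"
    and "finite I"
  shows "integrable M (\<lambda>x. (cmod (\<Sum>n\<in>I. b n * e n x))\<^sup>2)"
    and "(\<integral>x. (cmod (\<Sum>n\<in>I. b n * e n x))\<^sup>2 \<partial>M) = (\<Sum>n\<in>I. (cmod (b n))\<^sup>2)"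
proof -
  have eq: "complex_of_real ((cmod (\<Sum>n\<in>I. b n * e n x))\<^sup>2)
      = (\<Sum>m\<in>I. \<Sum>n\<in>I. (b m * cnj (b n)) * (e m x * cnj (e n x)))" for x
    by (simp add: complex_norm_square sum_product mult_ac del: of_real_power)
  have "integrable M (\<lambda>x. complex_of_real ((cmod (\<Sum>n\<in>I. b n * e n x))\<^sup>2))"
    unfolding eq by (intro Bochner_Integration.integrable_sum integrable_mult_right int)
  then show "integrable M (\<lambda>x. (cmod (\<Sum>n\<in>I. b n * e n x))\<^sup>2)"
    using complex_of_real_integrable_eq by blast
  have "complex_of_real (\<integral>x. (cmod (\<Sum>n\<in>I. b n * e n x))\<^sup>2 \<partial>M)
      = (\<integral>x. (\<Sum>m\<in>I. \<Sum>n\<in>I. (b m * cnj (b n)) * (e m x * cnj (e n x))) \<partial>M)"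
    unfolding integral_complex_of_real[symmetric] eq ..
  also have "\<dots> = (\<Sum>m\<in>I. \<Sum>n\<in>I. (b m * cnj (b n)) * (if m = n then 1 else 0))"
    by (simp only: Bochner_Integration.integral_sum Bochner_Integration.integrable_sum
        integrable_mult_right integral_mult_right_zero int orth)
  also have "\<dots> = complex_of_real (\<Sum>n\<in>I. (cmod (b n))\<^sup>2)"
    using \<open>finite I\<close> by (simp add: complex_norm_square del: of_real_power add: if_distrib sum.delta cong: if_cong)
  finally show "(\<integral>x. (cmod (\<Sum>n\<in>I. b n * e n x))\<^sup>2 \<partial>M) = (\<Sum>n\<in>I. (cmod (b n))\<^sup>2)"
    unfolding of_real_eq_iff .
qed

text \<open>\<open>4\<close> counts the exponentials in \<open>exp_cmod_le\<close>,
  \<open>exp 2\<close> bounds the expectation of each after normalization, and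
  \<open>p powr p\<close> comes from \<open>powr_le_exp\<close>.\<close>

definition moment_bound :: "real \<Rightarrow> real" where
  "moment_bound p = 4 * exp 2 * p powr p"

text \<open>This is the probability that the Paley--Zygmund argument yields when the fourth moment
  is at most \<open>moment_bound 4\<close> times the square of the second.\<close>

definition small_ball_const :: real where
  "small_ball_const = 1 / (4 * moment_bound 4)"

lemma moment_bound_4_ge: "1 \<le> moment_bound 4"
proof -
  have "1 \<le> exp (2::real)" "1 \<le> (4::real) powr 4"
    by (simp_all add: ge_one_powr_ge_zero)
  then have "1 * 1 \<le> exp 2 * 4 powr (4::real)"
    by (intro mult_mono) auto
  then show ?thesis
    by (simp add: moment_bound_def)
qed

lemma small_ball_const_pos: "0 < small_ball_const"
  using moment_bound_4_ge by (simp add: small_ball_const_def)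

text \<open>These properties are common to the three standard laws. As \<open>b\<close> is complex,
  the assumption \<open>mgf\<close> covers every real-linear functional of \<open>X n\<close>, with
  variance proxy \<open>(cmod b)\<^sup>2\<close>.\<close>

locale subgaussian_sequence = prob_space M for M :: "'a measure" +
  fixes X :: "nat \<Rightarrow> 'a \<Rightarrow> complex"
  assumes indep: "indep_vars (\<lambda>_. borel) X UNIV"
    and mean: "expectation (X n) = 0"
    and second_moment: "expectation (\<lambda>x. (cmod (X n x))\<^sup>2) = 1"
    and mgf: "(\<integral>\<^sup>+x. ennreal (exp (Re (b * X n x))) \<partial>M) \<le> ennreal (exp ((cmod b)\<^sup>2 / 2))"
begin

lemma measurable_X [measurable]: "X n \<in> borel_measurable M"
  using indep by (auto simp: indep_vars_def)

lemma mgf_sum: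
  assumes "finite I"
  shows "(\<integral>\<^sup>+x. ennreal (exp (Re (\<Sum>n\<in>I. b n * X n x))) \<partial>M)
    \<le> ennreal (exp ((\<Sum>n\<in>I. (cmod (b n))\<^sup>2) / 2))"
proof -
  have "(\<integral>\<^sup>+x. ennreal (exp (Re (\<Sum>n\<in>I. b n * X n x))) \<partial>M)
      = (\<integral>\<^sup>+x. (\<Prod>n\<in>I. ennreal (exp (Re (b n * X n x)))) \<partial>M)"
    using assms by (simp only: prod_ennreal exp_ge_zero exp_sum Re_sum)
  also have "\<dots> = (\<Prod>n\<in>I. \<integral>\<^sup>+x. ennreal (exp (Re (b n * X n x))) \<partial>M)"
  proof (rule indep_vars_nn_integral)
    show "indep_vars (\<lambda>_. borel) (\<lambda>n x. ennreal (exp (Re (b n * X n x)))) I"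
      by (rule indep_vars_compose2[OF indep_vars_subset[OF indep]]) auto
  qed (use assms in auto)
  also have "\<dots> \<le> (\<Prod>n\<in>I. ennreal (exp ((cmod (b n))\<^sup>2 / 2)))"
    using assms by induction (auto intro!: mult_mono mgf simp del: times_complex.sel)
  also have "\<dots> = ennreal (exp ((\<Sum>n\<in>I. (cmod (b n))\<^sup>2) / 2))"
    using assms by (simp only: prod_ennreal exp_ge_zero exp_sum sum_divide_distrib)
  finally show ?thesis .
qed

text \<open>After division by \<open>sqrt V\<close> the sum has exponential moments bounded by
  absolute constants; \<open>powr_le_exp\<close> and \<open>exp_cmod_le\<close> convert these into a
  \<open>p\<close>-th moment, and scaling back gives the factor
  \<open>V powr (p / 2)\<close>.\<close>

lemma moment_partial_sum_le:
  assumes "finite I" "0 < p"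
  shows "(\<integral>\<^sup>+x. ennreal (cmod (\<Sum>n\<in>I. b n * X n x) powr p) \<partial>M)
    \<le> ennreal (moment_bound p * (\<Sum>n\<in>I. (cmod (b n))\<^sup>2) powr (p / 2))"
proof -
  define V where "V = (\<Sum>n\<in>I. (cmod (b n))\<^sup>2)"
  have "V \<ge> 0"
    by (simp add: V_def sum_nonneg)
  show ?thesis
  proof (cases "V = 0")
    case True
    then have "b n = 0" if "n \<in> I" for n
      using that assms by (simp add: V_def sum_nonneg_eq_0_iff)
    then show ?thesis
      by simp
  next
    case False
    with \<open>V \<ge> 0\<close> have "V > 0" by simp
    define S where "S x = (\<Sum>n\<in>I. b n * X n x)" for x
    have [measurable]: "S \<in> borel_measurable M"
      unfolding S_def by measurable
    \<comment> \<open>The four multipliers in \<open>exp_cmod_le\<close> all have modulus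
      \<open>2\<close>, and \<open>exp 2\<close> is the bound of \<open>mgf_sum\<close> for
      coefficients whose squared moduli sum to \<open>4\<close>.\<close>
    have le: "(\<integral>\<^sup>+x. ennreal (exp (Re (c * (S x / sqrt V)))) \<partial>M) \<le> ennreal (exp 2)"
      if "cmod c = 2" for c
    proof -
      have "(\<integral>\<^sup>+x. ennreal (exp (Re (\<Sum>n\<in>I. (c * b n / sqrt V) * X n x))) \<partial>M)
          \<le> ennreal (exp ((\<Sum>n\<in>I. (cmod (c * b n / sqrt V))\<^sup>2) / 2))"
        by (rule mgf_sum) fact
      moreover have "(\<Sum>n\<in>I. (c * b n / sqrt V) * X n x) = c * (S x / sqrt V)" for x
        by (simp add: S_def sum_distrib_left sum_divide_distrib mult.assoc)
      moreover have "(\<Sum>n\<in>I. (cmod (c * b n / sqrt V))\<^sup>2) = 4"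
      proof -
        have "(\<Sum>n\<in>I. (cmod (c * b n / sqrt V))\<^sup>2) = (\<Sum>n\<in>I. 4 / V * (cmod (b n))\<^sup>2)"
          using \<open>V > 0\<close> that
          by (intro sum.cong) (auto simp: norm_mult norm_divide power_mult_distrib power_divide)
        also have "\<dots> = 4 / V * V"
          unfolding V_def by (rule sum_distrib_left[symmetric])
        finally show ?thesis
          using \<open>V > 0\<close> by simp
      qed
      ultimately show ?thesis
        using \<open>V > 0\<close> by (simp only:) simp
    qed
    have "cmod (S x) powr p \<le> V powr (p / 2) * p powr p * exp (cmod (S x / sqrt V))" for x
    proof -
      have "cmod (S x) powr p = V powr (p / 2) * cmod (S x / sqrt V) powr p"
        using \<open>V > 0\<close> by (simp add: norm_divide powr_divide powr_half_sqrt[symmetric] powr_powr)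
      also have "\<dots> \<le> V powr (p / 2) * (p powr p * exp (cmod (S x / sqrt V)))"
        using assms by (intro mult_left_mono powr_le_exp) auto
      finally show ?thesis by (simp add: mult.assoc)
    qed
    then have "(\<integral>\<^sup>+x. ennreal (cmod (S x) powr p) \<partial>M)
        \<le> (\<integral>\<^sup>+x. ennreal (V powr (p / 2) * p powr p) * ennreal (exp (cmod (S x / sqrt V))) \<partial>M)"
      by (intro nn_integral_mono) (simp add: ennreal_mult[symmetric])
    also have "\<dots> = ennreal (V powr (p / 2) * p powr p) * (\<integral>\<^sup>+x. ennreal (exp (cmod (S x / sqrt V))) \<partial>M)"
      by (rule nn_integral_cmult) measurable
    finally have le1: "(\<integral>\<^sup>+x. ennreal (cmod (S x) powr p) \<partial>M)
        \<le> ennreal (V powr (p / 2) * p powr p) * (\<integral>\<^sup>+x. ennreal (exp (cmod (S x / sqrt V))) \<partial>M)" .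
    have "(\<integral>\<^sup>+x. ennreal (exp (cmod (S x / sqrt V))) \<partial>M) \<le>
        (\<integral>\<^sup>+x. ennreal (exp (Re (2 * (S x / sqrt V)))) + ennreal (exp (Re (-2 * (S x / sqrt V))))
          + ennreal (exp (Re (2 * \<i> * (S x / sqrt V)))) + ennreal (exp (Re (-2 * \<i> * (S x / sqrt V)))) \<partial>M)"
      by (intro nn_integral_mono)
         (simp only: ennreal_plus[symmetric] add_nonneg_nonneg exp_ge_zero ennreal_leI exp_cmod_le)
    also have "\<dots> = (\<integral>\<^sup>+x. ennreal (exp (Re (2 * (S x / sqrt V)))) \<partial>M)
          + (\<integral>\<^sup>+x. ennreal (exp (Re (-2 * (S x / sqrt V)))) \<partial>M)
          + (\<integral>\<^sup>+x. ennreal (exp (Re (2 * \<i> * (S x / sqrt V)))) \<partial>M)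
          + (\<integral>\<^sup>+x. ennreal (exp (Re (-2 * \<i> * (S x / sqrt V)))) \<partial>M)"
    proof -
      have [measurable]: "(\<lambda>x. ennreal (exp (Re (c * (S x / sqrt V))))) \<in> borel_measurable M" for c
        by measurable
      show ?thesis
        by (simp only: nn_integral_add borel_measurable_add \<open>\<And>c. (\<lambda>x. ennreal (exp (Re (c * (S x / sqrt V))))) \<in> borel_measurable M\<close>)
    qed
    also have "\<dots> \<le> ennreal (exp 2) + ennreal (exp 2) + ennreal (exp 2) + ennreal (exp 2)"
      by (intro add_mono le) (auto simp: norm_mult)
    also have "\<dots> = ennreal (4 * exp 2)"
      by (simp add: ennreal_plus[symmetric] del: ennreal_plus)
    finally have "(\<integral>\<^sup>+x. ennreal (exp (cmod (S x / sqrt V))) \<partial>M) \<le> ennreal (4 * exp 2)" .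
    with le1 have "(\<integral>\<^sup>+x. ennreal (cmod (S x) powr p) \<partial>M)
        \<le> ennreal (V powr (p / 2) * p powr p) * ennreal (4 * exp 2)"
      by (meson mult_left_mono order_trans zero_le)
    then show ?thesis
      by (simp add: S_def V_def[symmetric] moment_bound_def ennreal_mult[symmetric] mult_ac)
  qed
qed

text \<open>The Bochner integral of a non-integrable function is zero by convention, so the value
  \<open>1\<close> forces integrability.\<close>

lemma integrable_X_norm2: "integrable M (\<lambda>x. (cmod (X n x))\<^sup>2)"
  using second_moment[of n] by (metis not_integrable_integral_eq zero_neq_one)

lemma integrable_X: "integrable M (X n)"
proof (rule Bochner_Integration.integrable_bound[where f = "\<lambda>x. 1 + (cmod (X n x))\<^sup>2"])
  have "cmod z \<le> 1 + (cmod z)\<^sup>2" for z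
    using zero_le_power2[of "cmod z - 1"] by (simp add: power2_diff) (smt (verit) norm_ge_zero)
  then show "AE x in M. norm (X n x) \<le> norm (1 + (cmod (X n x))\<^sup>2)"
    by (auto simp: abs_of_nonneg)
qed (use integrable_X_norm2 in auto)

lemma
  shows integrable_X_cnj_X: "integrable M (\<lambda>x. X m x * cnj (X n x))"
    and expectation_X_cnj_X: "expectation (\<lambda>x. X m x * cnj (X n x)) = (if m = n then 1 else 0)"
proof -
  have "integrable M (\<lambda>x. X m x * cnj (X n x)) \<and>
    expectation (\<lambda>x. X m x * cnj (X n x)) = (if m = n then 1 else 0)"
  proof (cases "m = n")
    case True
    have eq: "X n x * cnj (X n x) = complex_of_real ((cmod (X n x))\<^sup>2)" for x
      by (simp add: complex_norm_square del: of_real_power)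
    have int: "integrable M (\<lambda>x. complex_of_real ((cmod (X n x))\<^sup>2))"
      using integrable_X_norm2 by (rule integrable_of_real)
    have "expectation (\<lambda>x. complex_of_real ((cmod (X n x))\<^sup>2)) = of_real 1"
      by (subst integral_complex_of_real) (simp add: second_moment)
    with int show ?thesis
      unfolding True eq by simp
  next
    case False
    have [measurable]: "cnj \<in> borel_measurable borel"
      by (intro borel_measurable_continuous_onI continuous_intros)
    \<comment> \<open>Conjugating only the factor with index \<open>n\<close> makes the product over
      \<open>{m, n}\<close> equal to \<open>X m x * cnj (X n x)\<close>; independence and zero mean
      then make its expectation vanish.\<close>
    have "indep_vars (\<lambda>_. borel) (\<lambda>i x. if i = m then X i x else cnj (X i x)) {m, n}"
      by (rule indep_vars_compose2[OF indep_vars_subset[OF indep], where Y = "\<lambda>i y. if i = m then y else cnj y"])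
         (simp_all split: if_split)
    moreover have "integrable M (\<lambda>x. if i = m then X i x else cnj (X i x))" for i
      using integrable_X by (cases "i = m") auto
    ultimately show ?thesis
      using indep_vars_integrable[of "{m, n}" "\<lambda>i x. if i = m then X i x else cnj (X i x)"]
        indep_vars_lebesgue_integral[of "{m, n}" "\<lambda>i x. if i = m then X i x else cnj (X i x)"] False
      by (simp add: mean)
  qed
  then show "integrable M (\<lambda>x. X m x * cnj (X n x))"
    "expectation (\<lambda>x. X m x * cnj (X n x)) = (if m = n then 1 else 0)" by auto
qed

text \<open>The Paley--Zygmund argument: the fourth moment is comparable to the square of the second one.\<close>

lemma prob_partial_sum_small_le:
  fixes b :: "nat \<Rightarrow> complex"
  assumes "finite I"
  defines "V \<equiv> \<Sum>n\<in>I. (cmod (b n))\<^sup>2"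
  shows "prob {x \<in> space M. (cmod (\<Sum>n\<in>I. b n * X n x))\<^sup>2 < V / 2} \<le> 1 - small_ball_const"
proof -
  define S where "S x = (\<Sum>n\<in>I. b n * X n x)" for x
  have [measurable]: "S \<in> borel_measurable M"
    unfolding S_def by measurable
  define A where "A = {x \<in> space M. V / 2 \<le> (cmod (S x))\<^sup>2}"
  have [measurable]: "A \<in> events"
    unfolding A_def by measurable
  define C where "C = moment_bound 4"
  have "C \<ge> 1"
    using moment_bound_4_ge by (simp add: C_def)
  have "V \<ge> 0"
    by (simp add: V_def sum_nonneg)
  have "small_ball_const \<le> prob A"
  proof (cases "V = 0")
    case True
    then have "A = space M"
      by (auto simp: A_def)
    then show ?thesis
      using \<open>C \<ge> 1\<close> by (simp add: small_ball_const_def C_def prob_space)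
  next
    case False
    with \<open>V \<ge> 0\<close> have "V > 0" by simp
    have m4: "(\<integral>\<^sup>+x. ennreal ((cmod (S x)) ^ 4) \<partial>M) \<le> ennreal (C * V\<^sup>2)"
      using moment_partial_sum_le[OF assms(1), of 4 b] \<open>V > 0\<close>
      by (simp add: S_def V_def[symmetric] C_def powr_numeral)
    have int4: "integrable M (\<lambda>x. (cmod (S x)) ^ 4)"
      by (rule integrableI_bounded) (use m4 in \<open>auto intro: le_less_trans\<close>)
    have E4: "expectation (\<lambda>x. (cmod (S x)) ^ 4) \<le> C * V\<^sup>2"
      using m4 \<open>C \<ge> 1\<close> by (subst (asm) nn_integral_eq_integral[OF int4]) auto
    note E2 = norm2_orthonormal_sum[OF integrable_X_cnj_X expectation_X_cnj_X assms(1), of b,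
        folded S_def V_def]
    \<comment> \<open>A pointwise inequality between arithmetic and geometric means takes the place
      of Cauchy--Schwarz. The weight \<open>4 * C * V\<close> is chosen so that, in expectation, the
      fourth-moment term is at most \<open>V / 4\<close>; with \<open>V / 2\<close> from outside
      \<open>A\<close> this leaves \<open>V / 4 \<le> C * V * prob A\<close>.\<close>
    have pw: "(cmod (S x))\<^sup>2 \<le> V / 2 + (cmod (S x)) ^ 4 / (4 * C * V) + C * V * indicator A x"
      if "x \<in> space M" for x
    proof (cases "x \<in> A")
      case True
      define u where "u = (cmod (S x))\<^sup>2"
      have "0 \<le> (u - 2 * C * V)\<^sup>2 / (4 * C * V)"
        using \<open>C \<ge> 1\<close> \<open>V > 0\<close> by simp
      also have "\<dots> = u\<^sup>2 / (4 * C * V) + C * V - u"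
        using \<open>C \<ge> 1\<close> \<open>V > 0\<close> by (simp add: field_simps power2_eq_square)
      finally show ?thesis
        using True \<open>V > 0\<close> by (simp add: u_def flip: power_mult)
    next
      case False
      with that have "(cmod (S x))\<^sup>2 \<le> V / 2"
        by (simp add: A_def)
      moreover have "0 \<le> (cmod (S x)) ^ 4 / (4 * C * V)"
        using \<open>C \<ge> 1\<close> \<open>V > 0\<close> by simp
      ultimately show ?thesis
        using False by simp
    qed
    have int_parts: "integrable M (\<lambda>x. V / 2)"
      "integrable M (\<lambda>x. (cmod (S x)) ^ 4 / (4 * C * V))" "integrable M (\<lambda>x. C * V * indicator A x)"
      using int4 by (auto simp: emeasure_eq_measure)
    have "V = expectation (\<lambda>x. (cmod (S x))\<^sup>2)"
      using E2 by simp
    also have "\<dots> \<le> expectation (\<lambda>x. V / 2 + (cmod (S x)) ^ 4 / (4 * C * V) + C * V * indicator A x)"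
      by (rule integral_mono[OF E2(1) _ pw]) (intro Bochner_Integration.integrable_add int_parts)
    also have "\<dots> = V / 2 + expectation (\<lambda>x. (cmod (S x)) ^ 4) / (4 * C * V) + C * V * prob A"
      by (simp only: Bochner_Integration.integral_add Bochner_Integration.integrable_add int_parts) (simp add: prob_space)
    also have "\<dots> \<le> V / 2 + C * V\<^sup>2 / (4 * C * V) + C * V * prob A"
      using \<open>C \<ge> 1\<close> \<open>V > 0\<close> by (intro add_mono divide_right_mono E4) auto
    also have "C * V\<^sup>2 / (4 * C * V) = V / 4"
      using \<open>C \<ge> 1\<close> \<open>V > 0\<close> by (simp add: power2_eq_square)
    finally have "V / 4 \<le> C * V * prob A"
      by linarith
    then have "V * (1 / 4) \<le> V * (C * prob A)"
      by (simp add: mult_ac)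
    then have "1 / 4 \<le> C * prob A"
      using \<open>V > 0\<close> by (subst (asm) mult_le_cancel_left_pos)
    then show ?thesis
      using \<open>C \<ge> 1\<close> by (simp add: small_ball_const_def C_def[symmetric] field_simps)
  qed
  moreover have "{x \<in> space M. (cmod (S x))\<^sup>2 < V / 2} = space M - A"
    by (auto simp: A_def)
  ultimately show ?thesis
    by (simp add: S_def prob_compl)
qed

section \<open>Almost sure convergence of the random power series\<close>

lemma AE_linear_growth: "AE x in M. \<exists>C. \<forall>n. cmod (X n x) \<le> C * (real n + 1)"
proof -
  \<comment> \<open>The terms have expectations \<open>1 / (n + 1)\<^sup>2\<close>, so their sum has
    finite expectation and is almost surely finite; each single term is then bounded by the
    sum.\<close>
  define g where "g n x = ennreal ((cmod (X n x))\<^sup>2 / (real n + 1)\<^sup>2)" for n x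
  have [measurable]: "g n \<in> borel_measurable M" for n
    unfolding g_def by measurable
  have "(\<integral>\<^sup>+x. (\<Sum>n. g n x) \<partial>M) = (\<Sum>n. \<integral>\<^sup>+x. g n x \<partial>M)"
    by (rule nn_integral_suminf) measurable
  also have "\<dots> = (\<Sum>n. ennreal (inverse ((real (Suc n))\<^sup>2)))"
  proof (rule suminf_cong)
    show "(\<integral>\<^sup>+x. g n x \<partial>M) = ennreal (inverse ((real (Suc n))\<^sup>2))" for n
      unfolding g_def using integrable_X_norm2[of n]
      by (subst nn_integral_eq_integral) (auto simp: second_moment field_simps)
  qed
  also have "(\<Sum>n. ennreal (inverse ((real (Suc n))\<^sup>2))) \<noteq> top"
    using inverse_power_summable[of 2, where 'a = real]
    by (intro ennreal_suminf_neq_top) (subst summable_Suc_iff, auto)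
  finally have "AE x in M. (\<Sum>n. g n x) \<noteq> \<infinity>"
    by (intro nn_integral_PInf_AE) auto
  then show ?thesis
  proof eventually_elim
    case (elim x)
    then obtain r where r: "(\<Sum>n. g n x) = ennreal r" "0 \<le> r"
      by (cases "\<Sum>n. g n x") auto
    have "cmod (X n x) \<le> sqrt r * (real n + 1)" for n
    proof -
      have "g n x \<le> ennreal r"
        using sum_le_suminf[of "\<lambda>n. g n x" "{n}"] r by simp
      then have "(cmod (X n x))\<^sup>2 \<le> r * (real n + 1)\<^sup>2"
        using r by (simp add: g_def ennreal_le_iff divide_le_eq)
      then have "sqrt ((cmod (X n x))\<^sup>2) \<le> sqrt (r * (real n + 1)\<^sup>2)"
        by (rule real_sqrt_le_mono)
      then show ?thesis
        by (simp add: real_sqrt_mult)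
    qed
    then show ?case by blast
  qed
qed

text \<open>Factors of linear growth do not shrink the radius of convergence. Writing
  \<open>r\<close> as the square of \<open>\<rho>\<close>, one factor \<open>\<rho> ^ n\<close>
  absorbs the growth of \<open>X n x\<close> and the other keeps the series of \<open>a\<close>
  absolutely convergent.\<close>

lemma AE_conv_radius_random_ge:
  assumes "1 \<le> conv_radius a"
  shows "AE x in M. 1 \<le> conv_radius (\<lambda>n. a n * X n x)"
  using AE_linear_growth
proof eventually_elim
  case (elim x)
  then obtain C where C: "\<And>n. cmod (X n x) \<le> C * (real n + 1)" by blast
  show ?case
  proof (rule conv_radius_geI_ex')
    fix r :: real
    assume r: "0 < r" "ereal r < 1"
    define \<rho> where "\<rho> = sqrt r"
    have \<rho>: "0 < \<rho>" "\<rho> < 1" "r = \<rho> * \<rho>"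
      using r by (auto simp: \<rho>_def)
    have "(\<lambda>n. real n * \<rho> ^ n + \<rho> ^ n) \<longlonglongrightarrow> 0 + 0"
      using \<rho> by (intro tendsto_add powser_times_n_limit_0 LIMSEQ_power_zero) auto
    then have "Bseq (\<lambda>n. real n * \<rho> ^ n + \<rho> ^ n)"
      using convergentI Bseq_def convergent_imp_Bseq by blast
    then obtain B where B: "\<And>n. norm (real n * \<rho> ^ n + \<rho> ^ n) \<le> B"
      by (auto simp: Bseq_def)
    have "C \<ge> 0"
      using order_trans[OF norm_ge_zero C[of 0]] by simp
    have "ereal \<rho> < conv_radius a"
      using \<rho> assms by (metis ereal_less(3) less_le_trans)
    then have "summable (\<lambda>n. norm (a n * of_real \<rho> ^ n))"
      using \<rho> by (intro abs_summable_in_conv_radius) auto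
    then have "summable (\<lambda>n. C * B * norm (a n * of_real \<rho> ^ n))"
      by (rule summable_mult)
    then show "summable (\<lambda>n. a n * X n x * of_real r ^ n)"
    proof (rule summable_comparison_test'[where N = 0], goal_cases)
      case (1 n)
      have "norm (a n * X n x * of_real r ^ n) = norm (a n * of_real \<rho> ^ n) * (cmod (X n x) * \<rho> ^ n)"
        using \<rho> by (simp add: norm_mult norm_power power_mult_distrib)
      moreover have "cmod (X n x) * \<rho> ^ n \<le> C * B"
      proof -
        have "cmod (X n x) * \<rho> ^ n \<le> C * (real n + 1) * \<rho> ^ n"
          using \<rho> C by (intro mult_right_mono) auto
        also have "\<dots> = C * (real n * \<rho> ^ n + \<rho> ^ n)"
          by (simp add: algebra_simps)
        also have "\<dots> \<le> C * B"
          using B[of n] \<open>C \<ge> 0\<close> by (intro mult_left_mono) auto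
        finally show ?thesis .
      qed
      ultimately show ?case
        by (metis mult.commute mult_right_mono norm_ge_zero)
    qed
  qed
qed

section \<open>From partial sums to the full series\<close>

context
  fixes b :: "nat \<Rightarrow> complex"
  assumes conv: "AE x in M. summable (\<lambda>n. b n * X n x)"
    and l2: "summable (\<lambda>n. (cmod (b n))\<^sup>2)"
begin

text \<open>Fatou's lemma along the partial sums, whose moment bounds increase with \<open>N\<close>
  to the stated one.\<close>

lemma moment_series_le:
  assumes "0 < p"
  shows "(\<integral>\<^sup>+x. ennreal (cmod (\<Sum>n. b n * X n x) powr p) \<partial>M)
    \<le> ennreal (moment_bound p * (\<Sum>n. (cmod (b n))\<^sup>2) powr (p / 2))"
proof -
  define S where "S N x = (\<Sum>n<N. b n * X n x)" for N x
  have [measurable]: "S N \<in> borel_measurable M" for N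
    unfolding S_def by measurable
  have "(\<integral>\<^sup>+x. ennreal (cmod (\<Sum>n. b n * X n x) powr p) \<partial>M)
      = (\<integral>\<^sup>+x. liminf (\<lambda>N. ennreal (cmod (S N x) powr p)) \<partial>M)"
  proof (intro nn_integral_cong_AE)
    show "AE x in M. ennreal (cmod (\<Sum>n. b n * X n x) powr p) = liminf (\<lambda>N. ennreal (cmod (S N x) powr p))"
      using conv
    proof eventually_elim
      case (elim x)
      then have "(\<lambda>N. S N x) \<longlonglongrightarrow> (\<Sum>n. b n * X n x)"
        unfolding S_def by (rule summable_LIMSEQ)
      then have "(\<lambda>N. ennreal (cmod (S N x) powr p)) \<longlonglongrightarrow> ennreal (cmod (\<Sum>n. b n * X n x) powr p)"
        using assms by (intro tendsto_intros) auto
      then show ?case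
        by (intro lim_imp_Liminf[symmetric]) auto
    qed
  qed
  also have "\<dots> \<le> liminf (\<lambda>N. \<integral>\<^sup>+x. ennreal (cmod (S N x) powr p) \<partial>M)"
    by (rule nn_integral_liminf) measurable
  also have "\<dots> \<le> ennreal (moment_bound p * (\<Sum>n. (cmod (b n))\<^sup>2) powr (p / 2))"
  proof (rule Liminf_le, simp, rule always_eventually, rule allI)
    fix N
    have "(\<integral>\<^sup>+x. ennreal (cmod (S N x) powr p) \<partial>M)
        \<le> ennreal (moment_bound p * (\<Sum>n<N. (cmod (b n))\<^sup>2) powr (p / 2))"
      unfolding S_def using assms by (intro moment_partial_sum_le) auto
    also have "\<dots> \<le> ennreal (moment_bound p * (\<Sum>n. (cmod (b n))\<^sup>2) powr (p / 2))"
      using assms l2 unfolding moment_bound_def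
      by (intro ennreal_leI mult_left_mono powr_mono2 sum_le_suminf) (auto intro: sum_nonneg)
    finally show "(\<integral>\<^sup>+x. ennreal (cmod (S N x) powr p) \<partial>M)
        \<le> ennreal (moment_bound p * (\<Sum>n. (cmod (b n))\<^sup>2) powr (p / 2))" .
  qed
  finally show ?thesis .
qed

text \<open>Fatou's lemma for indicators. Passing from \<open>V / 2\<close> to \<open>V / 4\<close>
  leaves room for the limit: if the series has square modulus below \<open>V / 4\<close>, then so do
  its late partial sums, while half of their own variance eventually exceeds
  \<open>V / 4\<close>.\<close>

lemma prob_series_small_le:
  "prob {x \<in> space M. (cmod (\<Sum>n. b n * X n x))\<^sup>2 < (\<Sum>n. (cmod (b n))\<^sup>2) / 4} \<le> 1 - small_ball_const"
proof -
  define V where "V = (\<Sum>n. (cmod (b n))\<^sup>2)"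
  define B where "B = {x \<in> space M. (cmod (\<Sum>n. b n * X n x))\<^sup>2 < V / 4}"
  define BN where "BN N = {x \<in> space M. (cmod (\<Sum>n<N. b n * X n x))\<^sup>2 < (\<Sum>n<N. (cmod (b n))\<^sup>2) / 2}" for N
  have [measurable]: "B \<in> events" "BN N \<in> events" for N
    unfolding B_def BN_def by measurable
  have "V \<ge> 0"
    unfolding V_def by (intro suminf_nonneg l2) auto
  have "AE x in M. indicator B x \<le> liminf (\<lambda>N. indicator (BN N) x :: ennreal)"
    using conv
  proof eventually_elim
    case (elim x)
    show ?case
    proof (cases "x \<in> B")
      case True
      then have x: "x \<in> space M" "(cmod (\<Sum>n. b n * X n x))\<^sup>2 < V / 4"
        by (auto simp: B_def)
      then have "V > 0"
        using \<open>V \<ge> 0\<close> by (cases "V = 0") auto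
      have "(\<lambda>N. (\<Sum>n<N. b n * X n x)) \<longlonglongrightarrow> (\<Sum>n. b n * X n x)"
        using elim by (rule summable_LIMSEQ)
      then have "(\<lambda>N. (cmod (\<Sum>n<N. b n * X n x))\<^sup>2) \<longlonglongrightarrow> (cmod (\<Sum>n. b n * X n x))\<^sup>2"
        by (intro tendsto_intros)
      from order_tendstoD(2)[OF this x(2)]
      have "\<forall>\<^sub>F N in sequentially. (cmod (\<Sum>n<N. b n * X n x))\<^sup>2 < V / 4" .
      moreover have "(\<lambda>N. (\<Sum>n<N. (cmod (b n))\<^sup>2)) \<longlonglongrightarrow> V"
        unfolding V_def using l2 by (rule summable_LIMSEQ)
      from order_tendstoD(1)[OF this, of "V / 2"] \<open>V > 0\<close>
      have "\<forall>\<^sub>F N in sequentially. V / 2 < (\<Sum>n<N. (cmod (b n))\<^sup>2)"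
        by simp
      ultimately have "\<forall>\<^sub>F N in sequentially. 1 \<le> (indicator (BN N) x :: ennreal)"
        by eventually_elim (use x in \<open>auto simp: BN_def indicator_def\<close>)
      then have "1 \<le> liminf (\<lambda>N. indicator (BN N) x :: ennreal)"
        by (rule Liminf_bounded)
      with True show ?thesis by simp
    qed simp
  qed
  then have "(\<integral>\<^sup>+x. indicator B x \<partial>M) \<le> (\<integral>\<^sup>+x. liminf (\<lambda>N. indicator (BN N) x) \<partial>M)"
    by (rule nn_integral_mono_AE)
  also have "\<dots> \<le> liminf (\<lambda>N. \<integral>\<^sup>+x. indicator (BN N) x \<partial>M)"
    by (rule nn_integral_liminf) measurable
  also have "\<dots> \<le> ennreal (1 - small_ball_const)"
  proof (rule Liminf_le, simp, rule always_eventually, rule allI)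
    fix N
    show "(\<integral>\<^sup>+x. indicator (BN N) x \<partial>M) \<le> ennreal (1 - small_ball_const)"
      using prob_partial_sum_small_le[of "{..<N}" b]
      by (simp add: emeasure_eq_measure BN_def ennreal_leI)
  qed
  \<comment> \<open>The empty index set yields \<open>small_ball_const \<le> 1\<close>, needed to
    return from \<open>ennreal\<close> to the reals.\<close>
  finally show ?thesis
    using prob_partial_sum_small_le[of "{}" b]
    by (simp add: emeasure_eq_measure B_def V_def ennreal_le_iff)
qed

text \<open>The requirement on \<open>E\<close> does not involve \<open>b\<close>, so one event
  serves for all points of the disk. Removing the event \<open>B\<close> of small values costs at
  most \<open>1 - small_ball_const\<close>, hence \<open>E - B\<close> keeps probability at least
  \<open>small_ball_const / 2\<close>.\<close>

lemma moment_series_ge_on_event: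
  assumes "0 < p" and [measurable]: "E \<in> events" and E: "1 - small_ball_const / 2 \<le> prob E"
  shows "ennreal (small_ball_const / 2 / 2 powr p * (\<Sum>n. (cmod (b n))\<^sup>2) powr (p / 2))
    \<le> (\<integral>\<^sup>+x\<in>E. ennreal (cmod (\<Sum>n. b n * X n x) powr p) \<partial>M)"
proof -
  define V where "V = (\<Sum>n. (cmod (b n))\<^sup>2)"
  define B where "B = {x \<in> space M. (cmod (\<Sum>n. b n * X n x))\<^sup>2 < V / 4}"
  have [measurable]: "B \<in> events"
    unfolding B_def by measurable
  have "V \<ge> 0"
    unfolding V_def by (intro suminf_nonneg l2) auto
  have "prob E \<le> prob (E - B) + prob B"
    by (subst finite_measure_Diff') (auto intro!: finite_measure_mono)
  then have "small_ball_const / 2 \<le> prob (E - B)"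
    using E prob_series_small_le unfolding B_def V_def by linarith
  then have "ennreal (V powr (p / 2) / 2 powr p * (small_ball_const / 2))
      \<le> ennreal (V powr (p / 2) / 2 powr p) * emeasure M (E - B)"
    by (simp only: emeasure_eq_measure ennreal_mult[symmetric] measure_nonneg divide_nonneg_nonneg
        powr_ge_zero ennreal_leI mult_left_mono)
  also have "\<dots> = (\<integral>\<^sup>+x. ennreal (V powr (p / 2) / 2 powr p) * indicator (E - B) x \<partial>M)"
    by (simp add: nn_integral_cmult_indicator)
  also have "\<dots> \<le> (\<integral>\<^sup>+x\<in>E. ennreal (cmod (\<Sum>n. b n * X n x) powr p) \<partial>M)"
  proof (rule nn_integral_mono)
    fix x assume x: "x \<in> space M"
    show "ennreal (V powr (p / 2) / 2 powr p) * indicator (E - B) x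
        \<le> ennreal (cmod (\<Sum>n. b n * X n x) powr p) * indicator E x"
    proof (cases "x \<in> E - B")
      case True
      with x have "V / 4 \<le> (cmod (\<Sum>n. b n * X n x))\<^sup>2"
        by (simp add: B_def)
      then have "(V / 4) powr (p / 2) \<le> ((cmod (\<Sum>n. b n * X n x))\<^sup>2) powr (p / 2)"
        using assms \<open>V \<ge> 0\<close> by (intro powr_mono2) auto
      moreover have "((cmod w)\<^sup>2) powr (p / 2) = cmod w powr p" for w
        by (cases "w = 0") (auto simp: powr_powr simp flip: powr_numeral)
      moreover have "4 powr (p / 2) = 2 powr p"
      proof -
        have "(4::real) = 2 powr 2" by simp
        then show ?thesis by (simp only: powr_powr) simp
      qed
      ultimately show ?thesis
        using True \<open>V \<ge> 0\<close> by (simp add: powr_divide ennreal_leI)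
    qed simp
  qed
  finally show ?thesis
    by (simp add: V_def mult_ac)
qed

end

end

subsection \<open>Parseval's identity\<close>

lemma integral_cis_multiple:
  "(LINT \<theta>:{0..2 * pi}|lborel. cis (of_int k * \<theta>)) = (if k = 0 then of_real (2 * pi) else 0)"
proof (cases "k = 0")
  case True
  then show ?thesis
    by (simp add: set_lebesgue_integral_def scaleR_conv_of_real)
next
  case False
  have "(\<integral>\<theta>. indicator {0..2 * pi} \<theta> *\<^sub>R cis (of_int k * \<theta>) \<partial>lborel)
      = cis (of_int k * (2 * pi)) / (\<i> * of_int k) - cis (of_int k * 0) / (\<i> * of_int k)"
  proof (rule integral_FTC_Icc)
    fix x :: real
    have "((\<lambda>\<theta>. exp (\<i> * of_real (of_int k * \<theta>)) / (\<i> * of_int k)) has_vector_derivative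
        exp (\<i> * of_real (of_int k * x))) (at x within {0..2 * pi})"
      using False
      by (auto intro!: derivative_eq_intros has_vector_derivative_real_field simp: field_simps)
    then show "((\<lambda>\<theta>. cis (of_int k * \<theta>) / (\<i> * of_int k)) has_vector_derivative
        cis (of_int k * x)) (at x within {0..2 * pi})"
      by (simp add: cis_conv_exp)
  qed (auto intro!: continuous_intros)
  also have "cis (of_int k * (2 * pi)) = 1"
    using cis_multiple_2pi[of "of_int k"] by (simp add: mult_ac)
  finally show ?thesis
    using False by (simp add: set_lebesgue_integral_def)
qed

text \<open>The uniform law of an angle is both the normalized measure in Parseval's identity and
  the measure from which \<open>steinhaus_law\<close> is built.\<close>

abbreviation circle_measure :: "real measure" where
  "circle_measure \<equiv> uniform_measure lborel {0..2 * pi}"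

lemma prob_space_circle_measure: "prob_space circle_measure"
  by (intro prob_space_uniform_measure) auto

lemma integral_circle_measure:
  fixes g :: "real \<Rightarrow> 'b::{banach, second_countable_topology}"
  assumes [measurable]: "g \<in> borel_measurable borel"
  shows "(\<integral>\<theta>. g \<theta> \<partial>circle_measure) = (1 / (2 * pi)) *\<^sub>R (LINT \<theta>:{0..2 * pi}|lborel. g \<theta>)"
proof -
  have "1 / ennreal (2 * pi) = ennreal (1 / (2 * pi))"
    using divide_ennreal[of 1 "2 * pi"] by simp
  then have "circle_measure = density lborel (\<lambda>\<theta>. ennreal (indicator {0..2 * pi} \<theta> / (2 * pi)))"
    unfolding uniform_measure_def by (intro density_cong) (auto simp: indicator_def)
  then have "(\<integral>\<theta>. g \<theta> \<partial>circle_measure) = (\<integral>\<theta>. (indicator {0..2 * pi} \<theta> / (2 * pi)) *\<^sub>R g \<theta> \<partial>lborel)"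
    by (simp only:) (rule integral_density, auto)
  then show ?thesis
    by (simp add: set_lebesgue_integral_def flip: integral_scaleR_right)
qed

lemma
  shows integrable_cis_cnj_cis: "integrable circle_measure (\<lambda>\<theta>. cis (real m * \<theta>) * cnj (cis (real n * \<theta>)))"
    and integral_cis_cnj_cis:
      "(\<integral>\<theta>. cis (real m * \<theta>) * cnj (cis (real n * \<theta>)) \<partial>circle_measure) = (if m = n then 1 else 0)"
proof -
  interpret prob_space circle_measure by (rule prob_space_circle_measure)
  have eq: "cis (real m * \<theta>) * cnj (cis (real n * \<theta>)) = cis (of_int (int m - int n) * \<theta>)" for \<theta>
    by (simp add: cis_cnj cis_mult algebra_simps)
  show "integrable circle_measure (\<lambda>\<theta>. cis (real m * \<theta>) * cnj (cis (real n * \<theta>)))"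
    unfolding eq by (rule integrable_const_bound[where B = 1]) auto
  have "(\<integral>\<theta>. cis (of_int (int m - int n) * \<theta>) \<partial>circle_measure)
      = (1 / (2 * pi)) *\<^sub>R (LINT \<theta>:{0..2 * pi}|lborel. cis (of_int (int m - int n) * \<theta>))"
    by (rule integral_circle_measure) measurable
  then show "(\<integral>\<theta>. cis (real m * \<theta>) * cnj (cis (real n * \<theta>)) \<partial>circle_measure) = (if m = n then 1 else 0)"
    unfolding eq integral_cis_multiple by (simp add: scaleR_conv_of_real)
qed

text \<open>The square sum of the terms at \<open>z\<close> is thus a radial function, which lets
  the area integral be reduced to \<open>radial_measure\<close>.\<close>

lemma norm2_coeff_eq: "(cmod (c * z ^ n))\<^sup>2 = (cmod (c * of_real (cmod z) ^ n))\<^sup>2"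
  by (simp add: norm_mult norm_power)

lemma holomorphic_disk_coeffs:
  assumes "f holomorphic_on disk"
  defines "a \<equiv> fps_nth (fps_expansion f 0)"
  shows "1 \<le> conv_radius a" and "\<And>z. z \<in> disk \<Longrightarrow> (\<lambda>n. a n * z ^ n) sums f z"
    and "\<And>z. z \<in> disk \<Longrightarrow> summable (\<lambda>n. cmod (a n * z ^ n))"
    and "\<And>z. z \<in> disk \<Longrightarrow> summable (\<lambda>n. (cmod (a n * z ^ n))\<^sup>2)"
proof -
  have holo: "f holomorphic_on eball 0 1"
    using assms(1) by (simp add: disk_def one_ereal_def)
  show R: "1 \<le> conv_radius a"
    using conv_radius_fps_expansion[OF holo] by (simp add: a_def fps_conv_radius_def)
  show abs: "summable (\<lambda>n. cmod (a n * z ^ n))" if "z \<in> disk" for z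
  proof (rule abs_summable_in_conv_radius)
    have "ereal (norm z) < 1"
      using that by (simp add: disk_def)
    with R show "ereal (norm z) < conv_radius a"
      by (rule less_le_trans[rotated])
  qed
  show "(\<lambda>n. a n * z ^ n) sums f z" if "z \<in> disk" for z
  proof -
    have "eval_fps (fps_expansion f 0) z = f z"
      using eval_fps_expansion'[OF holo, of z] that by (simp add: disk_def)
    then show ?thesis
      using summable_sums[OF summable_norm_cancel[OF abs[OF that]]] by (simp add: eval_fps_def a_def)
  qed
  show "summable (\<lambda>n. (cmod (a n * z ^ n))\<^sup>2)" if "z \<in> disk" for z
  proof -
    have "(\<lambda>n. cmod (a n * z ^ n)) \<longlonglongrightarrow> 0"
      using abs[OF that] by (rule summable_LIMSEQ_zero)
    then have "\<forall>\<^sub>F n in sequentially. cmod (a n * z ^ n) < 1"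
      by (rule order_tendstoD) simp
    \<comment> \<open>Terms below one dominate their squares, so absolute convergence gives square
      summability.\<close>
    then have "\<forall>\<^sub>F n in sequentially. norm ((cmod (a n * z ^ n))\<^sup>2) \<le> cmod (a n * z ^ n)"
      by eventually_elim (simp add: power2_eq_square mult_left_le_one_le)
    then show ?thesis
      using abs[OF that] by (rule summable_comparison_test_ev)
  qed
qed

text \<open>Orthonormality of the characters settles the partial sums on the circle. They are
  uniformly bounded by the sum of the moduli of the terms, so dominated convergence passes to the
  limit.\<close>

lemma integral_mean_2_eq:
  assumes f: "f holomorphic_on disk" and s: "0 \<le> s" "s < 1"
  defines "a \<equiv> fps_nth (fps_expansion f 0)"
  shows "integral_mean 2 f s = sqrt (\<Sum>n. (cmod (a n * of_real s ^ n))\<^sup>2)"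
proof -
  define S where "S N \<theta> = (\<Sum>n<N. (a n * of_real s ^ n) * cis (real n * \<theta>))" for N \<theta>
  define F where "F \<theta> = f (of_real s * cis \<theta>)" for \<theta>
  interpret prob_space circle_measure by (rule prob_space_circle_measure)
  have disk: "of_real s * cis \<theta> \<in> disk" "of_real s \<in> disk" for \<theta>
    using s by (auto simp: disk_def norm_mult)
  have abs: "summable (\<lambda>n. cmod (a n * of_real s ^ n))"
    unfolding a_def by (rule holomorphic_disk_coeffs(3)[OF f disk(2)])
  have lim: "(\<lambda>N. S N \<theta>) \<longlonglongrightarrow> F \<theta>" for \<theta>
    using holomorphic_disk_coeffs(2)[OF f disk(1)[of \<theta>]]
    by (simp add: sums_def S_def F_def a_def power_mult_distrib mult.assoc Complex.DeMoivre)
  have [measurable]: "S N \<in> borel_measurable borel" for N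
    unfolding S_def by measurable
  have [measurable]: "F \<in> borel_measurable borel"
    by (rule borel_measurable_LIMSEQ_metric[OF _ lim]) measurable
  define B where "B = (\<Sum>n. cmod (a n * of_real s ^ n))"
  have bound: "cmod (S N \<theta>) \<le> B" for N \<theta>
  proof -
    have "cmod (S N \<theta>) \<le> (\<Sum>n<N. cmod (a n * of_real s ^ n))"
      unfolding S_def by (rule order_trans[OF norm_sum]) (simp add: norm_mult)
    also have "\<dots> \<le> B"
      unfolding B_def using abs by (intro sum_le_suminf) auto
    finally show ?thesis .
  qed
  have "(\<lambda>N. \<integral>\<theta>. (cmod (S N \<theta>))\<^sup>2 \<partial>circle_measure) \<longlonglongrightarrow> (\<integral>\<theta>. (cmod (F \<theta>))\<^sup>2 \<partial>circle_measure)"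
  proof (rule integral_dominated_convergence[where w = "\<lambda>_. B\<^sup>2"])
    show "AE \<theta> in circle_measure. (\<lambda>N. (cmod (S N \<theta>))\<^sup>2) \<longlonglongrightarrow> (cmod (F \<theta>))\<^sup>2"
      by (intro AE_I2 tendsto_intros lim)
    show "AE \<theta> in circle_measure. norm ((cmod (S N \<theta>))\<^sup>2) \<le> B\<^sup>2" for N
      using bound by (auto intro!: power_mono)
  qed auto
  moreover have "(\<integral>\<theta>. (cmod (S N \<theta>))\<^sup>2 \<partial>circle_measure) = (\<Sum>n<N. (cmod (a n * of_real s ^ n))\<^sup>2)" for N
    unfolding S_def
    by (rule norm2_orthonormal_sum(2)[OF integrable_cis_cnj_cis integral_cis_cnj_cis]) simp
  moreover have "(\<lambda>N. \<Sum>n<N. (cmod (a n * of_real s ^ n))\<^sup>2) \<longlonglongrightarrow> (\<Sum>n. (cmod (a n * of_real s ^ n))\<^sup>2)"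
    unfolding a_def by (intro summable_LIMSEQ holomorphic_disk_coeffs(4)[OF f disk(2)])
  ultimately have "(\<integral>\<theta>. (cmod (F \<theta>))\<^sup>2 \<partial>circle_measure) = (\<Sum>n. (cmod (a n * of_real s ^ n))\<^sup>2)"
    by (simp add: LIMSEQ_unique)
  moreover have "(\<integral>\<theta>. (cmod (F \<theta>))\<^sup>2 \<partial>circle_measure)
      = 1 / (2 * pi) * (LINT \<theta>:{0..2 * pi}|lborel. (cmod (F \<theta>))\<^sup>2)"
    by (subst integral_circle_measure) auto
  ultimately show ?thesis
    unfolding integral_mean_def F_def
    by (simp add: powr_half_sqrt integral_nonneg_AE suminf_nonneg set_lebesgue_integral_def
        holomorphic_disk_coeffs(4)[OF f disk(2), folded a_def] del: times_divide_eq_left)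
qed

subsection \<open>The standard random sequences\<close>

lemma mean_steinhaus_law: "(\<integral>y. y \<partial>steinhaus_law) = 0"
proof -
  have "(\<integral>y. y \<partial>steinhaus_law) = (\<integral>\<theta>. cis \<theta> \<partial>circle_measure)"
    unfolding steinhaus_law_def by (subst integral_distr) auto
  also have "\<dots> = (1 / (2 * pi)) *\<^sub>R (LINT \<theta>:{0..2 * pi}|lborel. cis \<theta>)"
    by (rule integral_circle_measure) measurable
  also have "\<dots> = 0"
    using integral_cis_multiple[of 1] by simp
  finally show ?thesis .
qed

lemma mean_bernoulli_law: "(\<integral>y. y \<partial>bernoulli_law) = 0"
  unfolding bernoulli_law_def
  by (subst integral_distr, simp, simp, subst integral_measure_pmf[of "{1, -1}"]) auto

lemma AE_cmod_bernoulli_law: "AE y in bernoulli_law. cmod y = 1"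
  unfolding bernoulli_law_def by (subst AE_distr_iff) (auto simp: AE_measure_pmf_iff)

lemma AE_cmod_steinhaus_law: "AE y in steinhaus_law. cmod y = 1"
  unfolding steinhaus_law_def by (subst AE_distr_iff) auto

text \<open>\<open>Re (b * Y x)\<close> has mean zero and lies in an interval of length
  \<open>2 * cmod b\<close>; Hoeffding's lemma gives the exponent
  \<open>(2 * cmod b)\<^sup>2 / 8\<close>, which is the stated one.\<close>

lemma (in prob_space) unimodular_mgf_le:
  assumes [measurable]: "Y \<in> borel_measurable M"
    and "AE x in M. cmod (Y x) = 1" and mean: "expectation Y = 0"
  shows "(\<integral>\<^sup>+x. ennreal (exp (Re (b * Y x))) \<partial>M) \<le> ennreal (exp ((cmod b)\<^sup>2 / 2))"
proof -
  interpret interval_bounded_random_variable M "\<lambda>x. Re (b * Y x)" "- cmod b" "cmod b"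
  proof unfold_locales
    show "AE x in M. Re (b * Y x) \<in> {- cmod b..cmod b}"
      using assms(2)
    proof eventually_elim
      case (elim x)
      have "\<bar>Re (b * Y x)\<bar> \<le> cmod (b * Y x)"
        by (rule abs_Re_le_cmod)
      then show ?case
        using elim by (simp only: norm_mult) auto
    qed
  qed measurable
  have "integrable M Y"
    using assms(2) by (intro integrable_const_bound[where B = 1]) auto
  then have "expectation (\<lambda>x. Re (b * Y x)) = Re (b * expectation Y)"
    by (subst integral_Re) auto
  then have "expectation (\<lambda>x. Re (b * Y x)) = 0"
    by (simp add: mean)
  from Hoeffdings_lemma_nn_integral_0[OF _ this, of 1] show ?thesis
    by (simp add: power2_eq_square)
qed

lemma mean_gaussian_law: "(\<integral>y. y \<partial>gaussian_law) = 0"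
proof -
  have "(\<integral>y. y \<partial>gaussian_law) = (\<integral>x. complex_of_real x \<partial>density lborel (\<lambda>x. ennreal (std_normal_density x)))"
    unfolding gaussian_law_def by (subst integral_distr) auto
  also have "\<dots> = of_real (\<integral>x. x \<partial>density lborel (\<lambda>x. ennreal (std_normal_density x)))"
    by (rule integral_complex_of_real)
  also have "(\<integral>x. x \<partial>density lborel (\<lambda>x. ennreal (std_normal_density x))) = 0"
    using integral_std_normal_moment_odd[of 0] by (subst integral_density) auto
  finally show ?thesis by simp
qed

lemma second_moment_gaussian_law: "(\<integral>y. (cmod y)\<^sup>2 \<partial>gaussian_law) = 1"
proof -
  have "(\<integral>y. (cmod y)\<^sup>2 \<partial>gaussian_law) = (\<integral>x. x\<^sup>2 \<partial>density lborel (\<lambda>x. ennreal (std_normal_density x)))"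
    unfolding gaussian_law_def by (subst integral_distr) auto
  also have "\<dots> = 1"
    using integral_std_normal_moment_even[of 1] by (subst integral_density) (auto simp: fact_2)
  finally show ?thesis .
qed

text \<open>The variable is real, so only \<open>Re b\<close> enters. Completing the square turns
  the integrand into \<open>exp (t\<^sup>2 / 2)\<close> times a normal density centred at
  \<open>t\<close>.\<close>

lemma mgf_gaussian_law_le:
  "(\<integral>\<^sup>+y. ennreal (exp (Re (b * y))) \<partial>gaussian_law) \<le> ennreal (exp ((cmod b)\<^sup>2 / 2))"
proof -
  define t where "t = Re b"
  have "(\<integral>\<^sup>+y. ennreal (exp (Re (b * y))) \<partial>gaussian_law)
      = (\<integral>\<^sup>+x. ennreal (std_normal_density x) * ennreal (exp (t * x)) \<partial>lborel)"
    unfolding gaussian_law_def t_def by (simp add: nn_integral_distr nn_integral_density)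
  also have "\<dots> = (\<integral>\<^sup>+x. ennreal (exp (t\<^sup>2 / 2)) * ennreal (normal_density t 1 x) \<partial>lborel)"
  proof (rule nn_integral_cong)
    fix x :: real
    have "- x\<^sup>2 / 2 + t * x = t\<^sup>2 / 2 + - (x - t)\<^sup>2 / 2"
      by (simp add: power2_eq_square field_simps)
    then have "exp (- x\<^sup>2 / 2) * exp (t * x) = exp (t\<^sup>2 / 2) * exp (- (x - t)\<^sup>2 / 2)"
      by (simp only: exp_add[symmetric])
    then have "std_normal_density x * exp (t * x) = exp (t\<^sup>2 / 2) * normal_density t 1 x"
      by (simp add: normal_density_def)
    then show "ennreal (std_normal_density x) * ennreal (exp (t * x))
        = ennreal (exp (t\<^sup>2 / 2)) * ennreal (normal_density t 1 x)"
      by (simp only: ennreal_mult[symmetric] normal_density_nonneg exp_ge_zero)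
  qed
  also have "\<dots> = ennreal (exp (t\<^sup>2 / 2)) * (\<integral>\<^sup>+x. ennreal (normal_density t 1 x) \<partial>lborel)"
    by (rule nn_integral_cmult) measurable
  also have "(\<integral>\<^sup>+x. ennreal (normal_density t 1 x) \<partial>lborel) = 1"
    using prob_space.emeasure_space_1[OF prob_space_normal_density[of 1 t]]
    by (simp add: emeasure_density)
  also have "ennreal (exp (t\<^sup>2 / 2)) * 1 \<le> ennreal (exp ((cmod b)\<^sup>2 / 2))"
    by (simp add: t_def cmod_power2)
  finally show ?thesis .
qed

lemma standard_random_sequence_subgaussian:
  assumes "prob_space M" "standard_random_sequence M X"
  shows "subgaussian_sequence M X"
proof -
  interpret prob_space M by fact
  have indep: "indep_vars (\<lambda>_. borel) X UNIV"
    using assms(2) by (simp add: standard_random_sequence_def)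
  have [measurable]: "X n \<in> borel_measurable M" for n
    using indep by (auto simp: indep_vars_def)
  \<comment> \<open>Bernoulli and Steinhaus variables are treated together: both are unimodular with
    mean zero.\<close>
  consider
      "\<And>n. AE y in distr M borel (X n). cmod y = 1" "\<And>n. (\<integral>y. y \<partial>distr M borel (X n)) = 0"
    | "\<And>n. distr M borel (X n) = gaussian_law"
    using assms(2) mean_bernoulli_law AE_cmod_bernoulli_law mean_steinhaus_law AE_cmod_steinhaus_law
    unfolding standard_random_sequence_def by metis
  then show ?thesis
  proof cases
    case 1
    have mean: "expectation (X n) = 0" for n
      using 1(2)[of n] by (subst (asm) integral_distr) auto
    have unimod: "AE x in M. cmod (X n x) = 1" for n
      using 1(1)[of n] by (subst (asm) AE_distr_iff) auto
    have "expectation (\<lambda>x. (cmod (X n x))\<^sup>2) = expectation (\<lambda>x. 1)" for n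
      using unimod[of n] by (intro integral_cong_AE) auto
    then show ?thesis
      by unfold_locales (auto intro!: indep unimodular_mgf_le unimod simp: mean prob_space simp del: times_complex.sel)
  next
    case 2
    show ?thesis
    proof unfold_locales
      fix n b
      show "expectation (X n) = 0"
        using mean_gaussian_law unfolding 2[of n, symmetric] by (subst (asm) integral_distr) auto
      show "expectation (\<lambda>x. (cmod (X n x))\<^sup>2) = 1"
        using second_moment_gaussian_law unfolding 2[of n, symmetric] by (subst (asm) integral_distr) auto
      show "(\<integral>\<^sup>+x. ennreal (exp (Re (b * X n x))) \<partial>M) \<le> ennreal (exp ((cmod b)\<^sup>2 / 2))"
        using mgf_gaussian_law_le[of b] unfolding 2[of n, symmetric] by (subst (asm) nn_integral_distr) auto
    qed (fact indep)
  qed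
qed

subsection \<open>Random symbols of weighted Bergman spaces\<close>

lemma bergman_norm_finite_iff: "bergman_norm p \<omega> f < \<infinity> \<longleftrightarrow> bergman_integral p \<omega> f < \<infinity>"
  by (auto simp: bergman_norm_def top.not_eq_extremum)

theorem theorem1p2:
  fixes p :: real and \<omega> :: "complex \<Rightarrow> real"
    and M :: "'a measure" and X :: "nat \<Rightarrow> 'a \<Rightarrow> complex"
  assumes "0 < p"
    and "admissible_weight p \<omega>"
    and "prob_space M"
    and "standard_random_sequence M X"
  shows "random_symbol_space M X (bergman_space p \<omega>) =
         mixed_norm_space 2 p (radial_measure \<omega>)"
proof -
  interpret subgaussian_sequence M X
    using assms by (intro standard_random_sequence_subgaussian)
  interpret D: finite_measure disk_area
    by (rule finite_measure_disk_area)
  interpret MD: pair_sigma_finite M disk_area ..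
  have w: "weight \<omega>"
    using assms(2) by (simp add: admissible_weight_def)
  then have [measurable]: "\<omega> \<in> borel_measurable disk_area"
    and \<omega>_pos: "\<And>z. z \<in> disk \<Longrightarrow> 0 < \<omega> z"
    by (auto simp: weight_def)
  have "(AE x in M. randomize X f x \<in> bergman_space p \<omega>) \<longleftrightarrow>
      (\<integral>\<^sup>+s. ennreal (integral_mean 2 f s powr p) \<partial>radial_measure \<omega>) < \<infinity>"
    if f: "f holomorphic_on disk" for f
  proof -
    \<comment> \<open>On the disk, \<open>V z\<close> will be the \<open>p\<close>-th power of the
      second mean of \<open>f\<close> on the circle through \<open>z\<close>, \<open>I x\<close> the
      Bergman integral of the randomized function, and \<open>J\<close> the mixed-norm integral
      written over the disk. The claim becomes that \<open>I\<close> is almost surely finite exactly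
      when \<open>J\<close> is finite.\<close>
    define a where "a = fps_nth (fps_expansion f 0)"
    define S where "S x z = (\<Sum>n. (a n * z ^ n) * X n x)" for x z
    define V where "V z = (\<Sum>n. (cmod (a n * z ^ n))\<^sup>2) powr (p / 2)" for z
    define I where "I x = (\<integral>\<^sup>+z. ennreal (cmod (S x z) powr p) * ennreal (\<omega> z) \<partial>disk_area)" for x
    define J where "J = (\<integral>\<^sup>+z. ennreal (V z) * ennreal (\<omega> z) \<partial>disk_area)"
    have [measurable]: "(\<lambda>z. ennreal (V z)) \<in> borel_measurable borel"
      unfolding V_def by measurable
    have [measurable]: "(\<lambda>w. S (fst w) (snd w)) \<in> borel_measurable (M \<Otimes>\<^sub>M disk_area)"
      unfolding S_def by measurable
    have [measurable]: "(\<lambda>z. S x z) \<in> borel_measurable disk_area"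
      "(\<lambda>x. S x z) \<in> borel_measurable M" for x z
      unfolding S_def by measurable
    note l2 = holomorphic_disk_coeffs(4)[OF f, folded a_def]
    \<comment> \<open>A single almost sure event gives convergence on the whole disk; holomorphy of
      the randomized function and convergence at each point both follow from it.\<close>
    have radius: "AE x in M. 1 \<le> conv_radius (\<lambda>n. a n * X n x)"
      unfolding a_def by (rule AE_conv_radius_random_ge[OF holomorphic_disk_coeffs(1)[OF f]])
    have conv: "AE x in M. summable (\<lambda>n. (a n * z ^ n) * X n x)" if z: "z \<in> disk" for z
      using radius
    proof eventually_elim
      case (elim x)
      have "ereal (norm z) < 1"
        using z by (simp add: disk_def)
      then have "summable (\<lambda>n. (a n * X n x) * z ^ n)"
        using elim by (intro summable_in_conv_radius) (rule less_le_trans)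
      then show ?case
        by (simp add: mult_ac)
    qed
    have randomize: "randomize X f x z = S x z" for x z
      by (simp add: randomize_def eval_fps_def S_def a_def mult_ac)
    have holo: "AE x in M. randomize X f x holomorphic_on disk"
      using radius
    proof eventually_elim
      case (elim x)
      have "disk \<subseteq> eball 0 (conv_radius (\<lambda>n. a n * X n x))"
      proof
        fix z assume "z \<in> disk"
        then have "ereal (norm z) < 1"
          by (simp add: disk_def)
        with elim have "ereal (norm z) < conv_radius (\<lambda>n. a n * X n x)"
          by (rule less_le_trans[rotated])
        then show "z \<in> eball 0 (conv_radius (\<lambda>n. a n * X n x))"
          by simp
      qed
      then show ?case
        unfolding randomize_def a_def[symmetric]
        by (intro holomorphic_on_eval_fps) (simp add: fps_conv_radius_def)
    qed
    have integral_eq: "bergman_integral p \<omega> (randomize X f x) = I x" for x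
      unfolding bergman_integral_def I_def randomize
      by (intro nn_integral_cong) (auto simp: ennreal_mult less_imp_le \<omega>_pos)
    have "AE x in M. randomize X f x \<in> bergman_space p \<omega> \<longleftrightarrow> I x < \<infinity>"
      using holo
      by eventually_elim (simp only: bergman_space_def bergman_norm_finite_iff integral_eq mem_Collect_eq simp_thms)
    then have 1: "(AE x in M. randomize X f x \<in> bergman_space p \<omega>) \<longleftrightarrow> (AE x in M. I x < \<infinity>)"
      by (rule eventually_subst)
    have "(\<integral>\<^sup>+s. ennreal (integral_mean 2 f s powr p) \<partial>radial_measure \<omega>)
        = (\<integral>\<^sup>+s. ennreal (V (of_real s)) \<partial>radial_measure \<omega>)"
    proof (rule nn_integral_cong)
      fix s assume "s \<in> space (radial_measure \<omega>)"
      then have s: "0 \<le> s" "s < 1"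
        by (auto simp: radial_measure_def space_restrict_space)
      then have "of_real s \<in> disk"
        by (simp add: disk_def)
      then show "ennreal (integral_mean 2 f s powr p) = ennreal (V (of_real s))"
        using integral_mean_2_eq[OF f s] suminf_nonneg[OF l2]
        by (simp add: V_def a_def powr_half_sqrt[symmetric] powr_powr)
    qed
    also have "\<dots> = (\<integral>\<^sup>+z. ennreal (V (of_real (cmod z))) * ennreal (\<omega> z) \<partial>disk_area)"
      by (rule nn_integral_radial_measure[OF w, symmetric]) measurable
    also have "\<dots> = J"
      unfolding J_def V_def norm2_coeff_eq[symmetric] ..
    finally have 2: "(\<integral>\<^sup>+s. ennreal (integral_mean 2 f s powr p) \<partial>radial_measure \<omega>) = J" .
    have meas_I [measurable]: "I \<in> borel_measurable M"
      unfolding I_def by measurable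
    have fubini: "(\<integral>\<^sup>+x\<in>E. I x \<partial>M)
        = (\<integral>\<^sup>+z. (\<integral>\<^sup>+x\<in>E. ennreal (cmod (S x z) powr p) \<partial>M) * ennreal (\<omega> z) \<partial>disk_area)"
      if [measurable]: "E \<in> events" for E
    proof -
      have "(\<integral>\<^sup>+x\<in>E. I x \<partial>M)
          = (\<integral>\<^sup>+x. \<integral>\<^sup>+z. ennreal (cmod (S x z) powr p) * indicator E x * ennreal (\<omega> z) \<partial>disk_area \<partial>M)"
        unfolding I_def
        by (subst nn_integral_multc[symmetric]) (auto intro!: nn_integral_cong simp: mult_ac)
      also have "\<dots> = (\<integral>\<^sup>+z. \<integral>\<^sup>+x. ennreal (cmod (S x z) powr p) * indicator E x * ennreal (\<omega> z) \<partial>M \<partial>disk_area)"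
        by (rule MD.Fubini'[symmetric]) measurable
      also have "\<dots> = (\<integral>\<^sup>+z. (\<integral>\<^sup>+x\<in>E. ennreal (cmod (S x z) powr p) \<partial>M) * ennreal (\<omega> z) \<partial>disk_area)"
        by (intro nn_integral_cong nn_integral_multc) measurable
      finally show ?thesis .
    qed
    \<comment> \<open>The upper moment bound, integrated over the disk, makes the expectation of
      \<open>I\<close> finite.\<close>
    have "AE x in M. I x < \<infinity>" if "J < \<infinity>"
    proof -
      have "(\<integral>\<^sup>+x. I x \<partial>M) = (\<integral>\<^sup>+x\<in>space M. I x \<partial>M)"
        by (intro nn_integral_cong) simp
      also have "\<dots> \<le> (\<integral>\<^sup>+z. ennreal (moment_bound p) * (ennreal (V z) * ennreal (\<omega> z)) \<partial>disk_area)"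
      proof (subst fubini, simp, rule nn_integral_mono)
        fix z assume "z \<in> space disk_area"
        then have z: "z \<in> disk" by simp
        have "(\<integral>\<^sup>+x\<in>space M. ennreal (cmod (S x z) powr p) \<partial>M) = (\<integral>\<^sup>+x. ennreal (cmod (S x z) powr p) \<partial>M)"
          by (intro nn_integral_cong) simp
        also have "\<dots> \<le> ennreal (moment_bound p * V z)"
          unfolding S_def V_def by (rule moment_series_le[OF conv[OF z] l2[OF z] \<open>0 < p\<close>])
        also have "\<dots> = ennreal (moment_bound p) * ennreal (V z)"
          by (simp add: ennreal_mult moment_bound_def V_def)
        finally show "(\<integral>\<^sup>+x\<in>space M. ennreal (cmod (S x z) powr p) \<partial>M) * ennreal (\<omega> z)
            \<le> ennreal (moment_bound p) * (ennreal (V z) * ennreal (\<omega> z))"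
          by (simp add: mult_right_mono flip: mult.assoc)
      qed
      also have "\<dots> = ennreal (moment_bound p) * J"
        unfolding J_def by (rule nn_integral_cmult) measurable
      also have "\<dots> < \<infinity>"
        using that by (simp add: ennreal_mult_less_top)
      finally have "AE x in M. I x \<noteq> \<infinity>"
        by (intro nn_integral_PInf_AE) auto
      then show ?thesis
        by eventually_elim (simp add: top.not_eq_extremum)
    qed
    moreover have "J < \<infinity>" if fin: "AE x in M. I x < \<infinity>"
    proof -
      \<comment> \<open>The sets \<open>E k\<close> increase to an event of probability one, so some
        \<open>E k\<close> is large enough for \<open>moment_series_ge_on_event\<close>. It is
        chosen before any point \<open>z\<close>, so the lower bound can be integrated over the
        disk.\<close>
      define E where "E k = {x \<in> space M. I x \<le> of_nat k}" for k
      have [measurable]: "E k \<in> events" for k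
        unfolding E_def by measurable
      have "(\<lambda>k. prob (E k)) \<longlonglongrightarrow> prob (\<Union>k. E k)"
      proof (rule finite_Lim_measure_incseq)
        show "incseq E"
          by (rule monoI) (auto simp: E_def elim!: order_trans)
      qed auto
      also have "prob (\<Union>k. E k) = 1"
      proof (rule prob_eq_1[THEN iffD2])
        show "AE x in M. x \<in> (\<Union>k. E k)"
          using fin AE_space
        proof eventually_elim
          case (elim x)
          then obtain k where "I x < of_nat k"
            using ennreal_Ex_less_of_nat[of "I x"] by auto
          with elim show ?case
            by (auto simp: E_def intro!: exI[of _ k])
        qed
      qed auto
      finally have "\<forall>\<^sub>F k in sequentially. 1 - small_ball_const / 2 < prob (E k)"
        using small_ball_const_pos by (intro order_tendstoD(1)) auto
      then obtain k where k: "1 - small_ball_const / 2 \<le> prob (E k)"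
        by (auto simp: eventually_sequentially intro: less_imp_le)
      define c where "c = small_ball_const / 2 / 2 powr p"
      have "c > 0"
        using small_ball_const_pos by (simp add: c_def)
      have "ennreal c * J = (\<integral>\<^sup>+z. ennreal c * (ennreal (V z) * ennreal (\<omega> z)) \<partial>disk_area)"
        unfolding J_def by (rule nn_integral_cmult[symmetric]) measurable
      also have "\<dots> \<le> (\<integral>\<^sup>+z. (\<integral>\<^sup>+x\<in>E k. ennreal (cmod (S x z) powr p) \<partial>M) * ennreal (\<omega> z) \<partial>disk_area)"
      proof (rule nn_integral_mono)
        fix z assume "z \<in> space disk_area"
        then have z: "z \<in> disk" by simp
        have "ennreal (c * V z) \<le> (\<integral>\<^sup>+x\<in>E k. ennreal (cmod (S x z) powr p) \<partial>M)"
          unfolding S_def V_def c_def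
          by (rule moment_series_ge_on_event[OF conv[OF z] l2[OF z] \<open>0 < p\<close> _ k]) measurable
        then show "ennreal c * (ennreal (V z) * ennreal (\<omega> z))
            \<le> (\<integral>\<^sup>+x\<in>E k. ennreal (cmod (S x z) powr p) \<partial>M) * ennreal (\<omega> z)"
          using \<open>c > 0\<close> by (simp add: ennreal_mult V_def mult_right_mono flip: mult.assoc)
      qed
      also have "\<dots> = (\<integral>\<^sup>+x\<in>E k. I x \<partial>M)"
        by (rule fubini[symmetric]) measurable
      \<comment> \<open>On \<open>E k\<close> the Bergman integral is at most \<open>k\<close>,
        which bounds \<open>c\<close> times \<open>J\<close> by \<open>k\<close>.\<close>
      also have "\<dots> \<le> (\<integral>\<^sup>+x. of_nat k \<partial>M)"
        by (intro nn_integral_mono) (auto simp: E_def indicator_def)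
      also have "\<dots> < \<infinity>"
        by (simp add: emeasure_space_1 of_nat_less_top)
      finally show ?thesis
        using \<open>c > 0\<close> by (auto simp: ennreal_mult_less_top)
    qed
    ultimately show ?thesis
      unfolding 1 2 by blast
  qed
  then show ?thesis
    unfolding random_symbol_space_def mixed_norm_space_def by auto
qed

end
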